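(* Let $N\ge1$ be an integer, $1<p<2$, $q>1$, $\delta=\frac{p}{2-p}$, $\eta=\frac{N-p}{p-1}$, $p_1=\frac{2N}{N+1}$, and $0<\alpha<\delta$. Let $w$ be any solution of $$(|w'|^{p-2}w')'+\frac{N-1}{r}|w'|^{p-2}w'+rw'+\alpha w+|w|^{q-1}w=0\qquad (E)$$ such that $\lim_{r\to\infty}r^\alpha w(r)=0$. If $w$ has a finite number of zeros, then: (i) if $p_1<p$, $\displaystyle\lim_{r\to\infty}r^\delta w(r)=\pm\ell$, where $\ell=\Big(\delta^{p-1}\frac{\delta-N}{\delta-\alpha}\Big)^{1/(2-p)}$; (ii) if $p<p_1$, $\displaystyle\lim_{r\to\infty}r^\eta w(r)=c$ for some $c\in\mathbb{R}$, $c\ne0$; (iii) if $p=p_1$, $\displaystyle\lim_{r\to\infty}r^N(\ln r)^{(N+1)/2}w(r)=\pm\varrho$, where $\varrho=\frac1N\Big(\frac{N(N-1)}{2(N-\alpha)}\Big)^{(N+1)/2}$.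
   Context: A solution of (E) is a function $w\in C^1((R_w,\infty))$, for some $R_w\ge0$, with $|w'|^{p-2}w'\in C^1((R_w,\infty))$, satisfying (E) on $(R_w,\infty)$. The sign $\pm$ depends on the solution. *)

theory Defs
  imports "HOL-Analysis.Analysis"
begin

text \<open>The signed power \<open>|x|\<^sup>a\<^sup>-\<^sup>1 x\<close>, extended by \<open>0\<close> at \<open>x = 0\<close>. For
  \<open>a = p - 1\<close> with \<open>p < 2\<close> the exponent is negative; the value at \<open>0\<close> is still the intended
  continuous extension because of the factor \<open>x\<close>.\<close>

definition spow :: "real \<Rightarrow> real \<Rightarrow> real" where
  "spow a x = \<bar>x\<bar> powr (a - 1) * x"

text \<open>\<open>w\<close> solves
  \<open>(|w'|\<^sup>p\<^sup>-\<^sup>2 w')' + (N - 1) / r |w'|\<^sup>p\<^sup>-\<^sup>2 w' + r w' + \<alpha> w + |w|\<^sup>q\<^sup>-\<^sup>1 w = 0\<close>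
  on \<open>(R, \<infinity>)\<close>. The values of the total function \<open>w\<close> on \<open>(-\<infinity>, R]\<close> are irrelevant.\<close>

definition is_solution ::
  "nat \<Rightarrow> real \<Rightarrow> real \<Rightarrow> real \<Rightarrow> real \<Rightarrow> (real \<Rightarrow> real) \<Rightarrow> bool" where
  "is_solution N p q \<alpha> R w \<longleftrightarrow>
     0 \<le> R \<and>
     w C1_differentiable_on {R<..} \<and>
     (\<lambda>r. spow (p - 1) (deriv w r)) C1_differentiable_on {R<..} \<and>
     (\<forall>r\<in>{R<..}.
        deriv (\<lambda>s. spow (p - 1) (deriv w s)) r
        + (real N - 1) / r * spow (p - 1) (deriv w r)
        + r * deriv w r + \<alpha> * w r + spow q (w r) = 0)"

end

theory Submission
  imports Defs "HOL-Real_Asymp.Real_Asymp"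
begin

text \<open>
  An eventually positive solution that tends to \<open>0\<close> is eventually decreasing. With \<open>t = ln r\<close>,
  \<open>x = w / (r |w'|)\<close> and \<open>v = |w'|\<^sup>p\<^sup>-\<^sup>1 / (r w)\<close> the equation becomes
  \<open>x' = - 1 + \<eta> x + (1 - (\<alpha> + e) x) / ((p - 1) v)\<close>, where \<open>e = w\<^sup>q\<^sup>-\<^sup>1\<close> is
  exponentially small, and \<open>y = r\<^sup>\<delta> w\<close> satisfies \<open>y' = (\<delta> - 1 / x) y\<close>. The hypothesis
  \<open>r\<^sup>\<alpha> w \<rightarrow> 0\<close> also excludes orbits on which \<open>v\<close> stays below \<open>1\<close>
  and the source terms in the equation for \<open>r\<^sup>\<alpha> w (1 - v)\<close> are integrable.

  If \<open>N < \<delta>\<close>, the point \<open>(x, y) = (1 / \<delta>, l)\<close> is a saddle, and every orbit that does not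
  converge to it is caught in an invariant quadrant where either \<open>x\<close> becomes negative or \<open>v \<rightarrow> 0\<close>.
  If \<open>\<delta> \<le> N\<close>, then \<open>v \<ge> 1\<close> and \<open>x \<le> 1 / N\<close> eventually, whence \<open>r\<^sup>N w \<rightarrow> 0\<close>,
  \<open>v \<rightarrow> \<infinity>\<close> and \<open>x \<rightarrow> 1 / \<eta>\<close>. The quantity \<open>Q = r\<^sup>N w (v - 1)\<close> decreases with
  \<open>Q' = - (N - \<alpha> - e) r\<^sup>N w\<close>. For \<open>\<delta> < N\<close> it has a positive limit, which determines the
  limit of \<open>r\<^sup>\<eta> w\<close>; for \<open>\<delta> = N\<close> one has \<open>r\<^sup>N w \<sim> Q\<^bsup>1 / (p - 1)\<^esup> / N\<close>, so that the
  equation for \<open>Q\<close> can be integrated asymptotically.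
\<close>

section \<open>Scalar differential inequalities\<close>

text \<open>At the last time s up to which the bound holds, either \<open>f s < c\<close> and
  continuity prolongs it, or \<open>f s = c\<close> and the negative derivative does. The sign of f'
  is asked for only at contacts before which the bound has held; this lets one bound of a coupled
  system enter the proof of another.\<close>

lemma barrier_le:
  fixes f f' :: "real \<Rightarrow> real"
  assumes deriv: "\<And>t. T \<le> t \<Longrightarrow> (f has_real_derivative f' t) (at t)"
    and init: "f T \<le> c"
    and neg: "\<And>t. T \<le> t \<Longrightarrow> f t = c \<Longrightarrow> (\<And>s. T \<le> s \<Longrightarrow> s \<le> t \<Longrightarrow> f s \<le> c) \<Longrightarrow> f' t < 0"
    and "T \<le> t"
  shows "f t \<le> c"
proof (rule ccontr)
  assume "\<not> f t \<le> c"
  hence ft: "f t > c" by simp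
  define A where "A = {a \<in> {T..t}. \<forall>s\<in>{T..a}. f s \<le> c}"
  have TA: "T \<in> A" using init \<open>T \<le> t\<close> by (auto simp: A_def)
  have bdd: "bdd_above A" by (rule bdd_aboveI[of _ t]) (auto simp: A_def)
  define s where "s = Sup A"
  have Ts: "T \<le> s" unfolding s_def using TA bdd by (rule cSup_upper)
  have st: "s \<le> t" unfolding s_def by (rule cSup_least) (use TA in \<open>auto simp: A_def\<close>)
  have below: "f a \<le> c" if a: "T \<le> a" "a < s" for a
  proof -
    obtain b where "b \<in> A" "a < b"
      using a TA less_cSup_iff[OF _ bdd, of a] unfolding s_def by blast
    thus ?thesis using a by (auto simp: A_def)
  qed
  have cont: "isCont f a" if "T \<le> a" for a using deriv[OF that] by (rule DERIV_isCont)
  have fs: "f s \<le> c"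
  proof (cases "T = s")
    case False
    show ?thesis
    proof (rule tendsto_upperbound)
      show "(f \<longlongrightarrow> f s) (at_left s)"
        using cont[OF Ts] by (simp add: isCont_def filterlim_at_split)
      show "\<forall>\<^sub>F a in at_left s. f a \<le> c"
        using False Ts below by (intro eventually_at_leftI[of T]) auto
    qed simp
  qed (use init in simp)
  have "s < t" using st ft fs by (cases "s = t") auto
  have right: "\<exists>d>0. \<forall>a. s < a \<and> a < s + d \<longrightarrow> f a \<le> c"
  proof (cases "f s = c")
    case True
    have "f' s < 0" using neg[OF Ts True] below fs by (metis order_le_less)
    then obtain d where "d > 0" "\<And>h. h > 0 \<Longrightarrow> h < d \<Longrightarrow> f (s + h) < f s"
      using DERIV_neg_dec_right[OF deriv[OF Ts]] by blast
    moreover have "f a \<le> c" if "s < a" "a < s + d" for a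
      using \<open>\<And>h. h > 0 \<Longrightarrow> h < d \<Longrightarrow> f (s + h) < f s\<close>[of "a - s"] that True by simp
    ultimately show ?thesis by blast
  next
    case False
    hence "f s < c" using fs by simp
    have "\<forall>\<^sub>F a in at_right s. f a < c"
      using cont[OF Ts] \<open>f s < c\<close> 
      by (intro order_tendstoD[of f "f s"]) (auto simp: isCont_def filterlim_at_split)
    then obtain b where "b > s" "\<And>a. s < a \<Longrightarrow> a < b \<Longrightarrow> f a < c"
      by (auto simp: eventually_at_right[of s "s + 1"])
    thus ?thesis by (intro exI[of _ "b - s"]) (auto intro: less_imp_le)
  qed
  then obtain d where d: "d > 0" "\<And>a. s < a \<Longrightarrow> a < s + d \<Longrightarrow> f a \<le> c" by blast
  define b where "b = min t (s + d / 2)"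
  have "f a \<le> c" if "T \<le> a" "a \<le> b" for a
    using below[of a] fs d(2)[of a] that d(1) by (cases a s rule: linorder_cases) (auto simp: b_def)
  hence "b \<in> A" using Ts d(1) \<open>s < t\<close> by (auto simp: A_def b_def)
  hence "b \<le> s" unfolding s_def using bdd by (rule cSup_upper)
  thus False using \<open>s < t\<close> d by (auto simp: b_def)
qed

lemma barrier_ge:
  fixes f f' :: "real \<Rightarrow> real"
  assumes deriv: "\<And>t. T \<le> t \<Longrightarrow> (f has_real_derivative f' t) (at t)"
    and init: "c \<le> f T"
    and pos: "\<And>t. T \<le> t \<Longrightarrow> f t = c \<Longrightarrow> (\<And>s. T \<le> s \<Longrightarrow> s \<le> t \<Longrightarrow> c \<le> f s) \<Longrightarrow> 0 < f' t"
    and "T \<le> t"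
  shows "c \<le> f t"
proof -
  have "- f t \<le> - c"
    by (rule barrier_le[of T "\<lambda>t. - f t" "\<lambda>t. - f' t"])
      (use assms in \<open>auto intro!: DERIV_minus\<close>)
  thus ?thesis by simp
qed

text \<open>The integrating factor makes exp (- c t) f(t) nondecreasing. Both signs of
  \<open>c\<close> and \<open>f\<close> are covered, so decay of y follows by passing to - y with a
  negative rate.\<close>

lemma exp_growth:
  fixes f f' :: "real \<Rightarrow> real"
  assumes deriv: "\<And>t. T \<le> t \<Longrightarrow> (f has_real_derivative f' t) (at t)"
    and ge: "\<And>t. T \<le> t \<Longrightarrow> c * f t \<le> f' t"
    and "T \<le> s" "s \<le> t"
  shows "f s * exp (c * (t - s)) \<le> f t"
proof -
  have "exp (- c * s) * f s \<le> exp (- c * t) * f t"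
  proof (rule DERIV_nonneg_imp_nondecreasing[OF \<open>s \<le> t\<close>])
    fix a assume a: "s \<le> a" "a \<le> t"
    hence "T \<le> a" using assms(3) by simp
    have "((\<lambda>t. exp (- c * t) * f t) has_real_derivative exp (- c * a) * (f' a - c * f a)) (at a)"
      by (rule derivative_eq_intros refl deriv[OF \<open>T \<le> a\<close>])+ (simp add: algebra_simps)
    moreover have "exp (- c * a) * (f' a - c * f a) \<ge> 0" using ge[OF \<open>T \<le> a\<close>] by simp
    ultimately show "\<exists>y. ((\<lambda>t. exp (- c * t) * f t) has_real_derivative y) (at a) \<and> y \<ge> 0" by blast
  qed
  hence "exp (c * t) * (exp (- c * s) * f s) \<le> exp (c * t) * (exp (- c * t) * f t)"
    by (rule mult_left_mono) simp
  also have "exp (c * t) * (exp (- c * t) * f t) = f t" 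
    by (simp add: exp_minus field_simps)
  also have "exp (c * t) * (exp (- c * s) * f s) = f s * exp (c * (t - s))"
    by (simp add: exp_minus exp_diff right_diff_distrib field_simps)
  finally show ?thesis .
qed

lemma exp_growth_filterlim:
  fixes f f' :: "real \<Rightarrow> real"
  assumes "\<And>t. T \<le> t \<Longrightarrow> (f has_real_derivative f' t) (at t)"
    and "\<And>t. T \<le> t \<Longrightarrow> c * f t \<le> f' t" "c > 0" "f T > 0"
  shows "filterlim f at_top at_top"
proof (rule filterlim_at_top_mono)
  show "\<forall>\<^sub>F t in at_top. f T * exp (c * (t - T)) \<le> f t"
    using eventually_ge_at_top[of T] by eventually_elim (use exp_growth[OF assms(1,2)] in auto)
  show "filterlim (\<lambda>t. f T * exp (c * (t - T))) at_top at_top"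
  proof (rule filterlim_tendsto_pos_mult_at_top[OF tendsto_const \<open>f T > 0\<close>])
    show "filterlim (\<lambda>t. exp (c * (t - T))) at_top at_top"
      using \<open>c > 0\<close> by real_asymp
  qed
qed

lemma eventually_le_of_deriv:
  fixes f f' :: "real \<Rightarrow> real"
  assumes deriv: "\<And>t. T \<le> t \<Longrightarrow> (f has_real_derivative f' t) (at t)"
    and neg: "\<And>t. T \<le> t \<Longrightarrow> \<theta> \<le> f t \<Longrightarrow> f' t \<le> - c" and "c > 0"
  shows "\<exists>S\<ge>T. \<forall>t\<ge>S. f t \<le> \<theta>"
proof -
  have "\<exists>S\<ge>T. f S \<le> \<theta>"
  proof (rule ccontr)
    assume "\<not> ?thesis"
    hence above: "\<And>t. T \<le> t \<Longrightarrow> \<theta> \<le> f t" by force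
    \<comment> \<open>By this time the line of slope - c through (T, f T) has reached \<theta> - 1,
      below the level that f is assumed to keep.\<close>
    define t where "t = T + (f T - \<theta> + 1) / c"
    have "T \<le> t" using above[of T] \<open>c > 0\<close> by (simp add: t_def)
    have "f t + c * t \<le> f T + c * T"
    proof (rule DERIV_nonpos_imp_nonincreasing[OF \<open>T \<le> t\<close>])
      fix a assume "T \<le> a"
      have "((\<lambda>t. f t + c * t) has_real_derivative f' a + c) (at a)"
        by (rule derivative_eq_intros refl deriv[OF \<open>T \<le> a\<close>])+ simp
      moreover have "f' a + c \<le> 0" using neg[OF \<open>T \<le> a\<close>] above[OF \<open>T \<le> a\<close>] by simp
      ultimately show "\<exists>y. ((\<lambda>t. f t + c * t) has_real_derivative y) (at a) \<and> y \<le> 0" by blast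
    qed
    moreover have "c * t = c * T + f T - \<theta> + 1" using \<open>c > 0\<close> by (simp add: t_def field_simps)
    ultimately show False using above[OF \<open>T \<le> t\<close>] by simp
  qed
  then obtain S where S: "S \<ge> T" "f S \<le> \<theta>" by blast
  have "f t \<le> \<theta>" if "t \<ge> S" for t
  proof (rule barrier_le[of S f f'])
    show "f' a < 0" if "S \<le> a" "f a = \<theta>" for a
      using neg[of a] that S \<open>c > 0\<close> by simp
  qed (use S that deriv in auto)
  thus ?thesis using S by blast
qed

text \<open>The strip between \<open>a\<close> and \<open>b\<close> can be crossed downwards only.
  Once f is at or below \<open>b\<close> it stays there, and the uniform slope then brings it to
  \<open>a\<close> or below for good.\<close>

lemma strip_dichotomy:
  fixes f f' :: "real \<Rightarrow> real"
  assumes deriv: "\<And>t. T \<le> t \<Longrightarrow> (f has_real_derivative f' t) (at t)"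
    and neg: "\<And>t. T \<le> t \<Longrightarrow> a \<le> f t \<Longrightarrow> f t \<le> b \<Longrightarrow> f' t \<le> - c" and "c > 0" "a \<le> b"
  shows "(\<forall>t\<ge>T. b \<le> f t) \<or> (\<exists>S\<ge>T. \<forall>t\<ge>S. f t \<le> a)"
proof (rule disjCI)
  assume "\<not> (\<exists>S\<ge>T. \<forall>t\<ge>S. f t \<le> a)"
  show "\<forall>t\<ge>T. b \<le> f t"
  proof (rule ccontr)
    assume "\<not> ?thesis"
    then obtain S where S: "S \<ge> T" "f S \<le> b" by force
    have le: "f t \<le> b" if "t \<ge> S" for t
    proof (rule barrier_le[of S f f'])
      show "f' t < 0" if "S \<le> t" "f t = b" for t
        using neg[of t] that S \<open>c > 0\<close> \<open>a \<le> b\<close> by simp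
    qed (use S that deriv in auto)
    have "\<exists>S'\<ge>S. \<forall>t\<ge>S'. f t \<le> a"
      by (rule eventually_le_of_deriv[of S f f' a c]) (use S deriv neg le \<open>c > 0\<close> in auto)
    with S \<open>\<not> (\<exists>S\<ge>T. \<forall>t\<ge>S. f t \<le> a)\<close> show False by (meson order_trans)
  qed
qed

text \<open>The factor exp (- (C/k) exp (- k t)) has logarithmic derivative C exp (- k t), which
  compensates the possible loss of J. It lies in (0, 1], so J never falls below the initial value of
  the product.\<close>

lemma lower_bound_of_integrable_decay:
  fixes J J' :: "real \<Rightarrow> real"
  assumes deriv: "\<And>t. T \<le> t \<Longrightarrow> (J has_real_derivative J' t) (at t)"
    and ge: "\<And>t. T \<le> t \<Longrightarrow> - C * exp (- k * t) * J t \<le> J' t"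
    and "J T > 0" "k > 0" "C \<ge> 0"
  shows "\<exists>c>0. \<forall>t\<ge>T. c \<le> J t"
proof -
  define K where "K t = J t * exp (- (C / k) * exp (- k * t))" for t
  have mono: "K T \<le> K t" if "T \<le> t" for t
  proof (rule DERIV_nonneg_imp_nondecreasing[OF that])
    fix a assume "T \<le> a"
    let ?E = "exp (- (C / k) * exp (- k * a))"
    have "(K has_real_derivative ?E * (J' a + C * exp (- k * a) * J a)) (at a)"
      unfolding K_def by (rule derivative_eq_intros refl deriv[OF \<open>T \<le> a\<close>])+
        (use \<open>k > 0\<close> in \<open>simp add: field_simps\<close>)
    moreover have "?E * (J' a + C * exp (- k * a) * J a) \<ge> 0"
      using ge[OF \<open>T \<le> a\<close>] by (intro mult_nonneg_nonneg) auto
    ultimately show "\<exists>y. (K has_real_derivative y) (at a) \<and> y \<ge> 0" by blast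
  qed
  have "K T > 0" using assms(3) by (simp add: K_def)
  moreover have "K T \<le> J t" if "T \<le> t" for t
  proof -
    have "K t > 0" using mono[OF that] \<open>K T > 0\<close> by simp
    hence "J t > 0" by (simp add: K_def zero_less_mult_iff)
    have "exp (- (C / k) * exp (- k * t)) \<le> 1" using \<open>k > 0\<close> \<open>C \<ge> 0\<close> by simp
    hence "K t \<le> J t" unfolding K_def using \<open>J t > 0\<close>
      by (metis less_eq_real_def mult.right_neutral mult_left_mono)
    thus ?thesis using mono[OF that] by simp
  qed
  ultimately show ?thesis by blast
qed

text \<open>The equilibrium \<open>1 / a\<close> is repelling, so only a solution that tends to it stays bounded.\<close>

lemma unstable_linear_tendsto:
  fixes x x' :: "real \<Rightarrow> real"
  assumes deriv: "\<And>t. T \<le> t \<Longrightarrow> (x has_real_derivative x' t) (at t)"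
    and bd: "\<And>t. T \<le> t \<Longrightarrow> \<bar>x t\<bar> \<le> B"
    and lim: "((\<lambda>t. x' t - a * x t + 1) \<longlongrightarrow> 0) at_top" and "a > 0"
  shows "(x \<longlongrightarrow> 1 / a) at_top"
proof (rule tendstoI)
  fix e :: real assume "e > 0"
  define k where "k = e / 2"
  have "k > 0" using \<open>e > 0\<close> by (simp add: k_def)
  have "\<forall>\<^sub>F t in at_top. \<bar>x' t - a * x t + 1\<bar> < a * k"
    using tendstoD[OF lim, of "a * k"] \<open>a > 0\<close> \<open>k > 0\<close> by simp
  then obtain S where S: "S \<ge> T" "\<And>t. t \<ge> S \<Longrightarrow> \<bar>x' t - a * x t + 1\<bar> < a * k"
    unfolding eventually_at_top_linorder by (metis nle_le order_trans)
  \<comment> \<open>\<sigma> selects the side of 1/a. As the error is below a k, the excess f of the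
    distance over k satisfies f' >= a f; a positive excess would grow without bound, against the
    bound \<open>B\<close>.\<close>
  have unb: False if "\<sigma> \<in> {1, -1}" "t \<ge> S" "\<sigma> * (x t - 1 / a) - k > 0" for \<sigma> t
  proof -
    have "filterlim (\<lambda>t. \<sigma> * (x t - 1 / a) - k) at_top at_top"
    proof (rule exp_growth_filterlim)
      fix s assume "t \<le> s"
      hence s: "s \<ge> S" "s \<ge> T" using S that by auto
      show "((\<lambda>t. \<sigma> * (x t - 1 / a) - k) has_real_derivative \<sigma> * x' s) (at s)"
        by (rule derivative_eq_intros refl deriv[OF s(2)])+ simp
      show "a * (\<sigma> * (x s - 1 / a) - k) \<le> \<sigma> * x' s"
        using S(2)[OF s(1)] that(1) \<open>a > 0\<close> by (auto simp: algebra_simps)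
    qed (use that \<open>a > 0\<close> in auto)
    hence "\<forall>\<^sub>F s in at_top. \<sigma> * (x s - 1 / a) - k > B + 1 / a"
      by (simp add: filterlim_at_top_dense)
    moreover have "\<forall>\<^sub>F s in at_top. \<bar>x s\<bar> \<le> B"
      using eventually_ge_at_top[of T] by eventually_elim (rule bd)
    ultimately have "\<forall>\<^sub>F s::real in at_top. False"
      by eventually_elim (use that(1) \<open>k > 0\<close> \<open>a > 0\<close> in \<open>auto simp: abs_le_iff\<close>, smt (verit) divide_pos_pos)
    thus False by simp
  qed
  show "\<forall>\<^sub>F t in at_top. dist (x t) (1 / a) < e"
    using eventually_ge_at_top[of S]
  proof eventually_elim
    case (elim t)
    show ?case using unb[of 1 t] unb[of "-1" t] elim \<open>e > 0\<close> by (fastforce simp: dist_real_def k_def abs_less_iff not_less)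
  qed
qed

lemma nonincreasing_tendsto:
  fixes f :: "real \<Rightarrow> real"
  assumes "\<And>s t. T \<le> s \<Longrightarrow> s \<le> t \<Longrightarrow> f t \<le> f s" and "\<And>t. T \<le> t \<Longrightarrow> c \<le> f t"
  shows "\<exists>L\<ge>c. (f \<longlongrightarrow> L) at_top"
proof -
  have bdd: "bdd_below (f ` {T..})" by (rule bdd_belowI[of _ c]) (use assms(2) in auto)
  define L where "L = Inf (f ` {T..})"
  have "L \<ge> c" unfolding L_def by (rule cInf_greatest) (use assms(2) in auto)
  have ge: "f t \<ge> L" if "t \<ge> T" for t 
    unfolding L_def by (rule cInf_lower[OF _ bdd]) (use that in auto)
  have "(f \<longlongrightarrow> L) at_top"
  proof (rule order_tendstoI)
    fix a assume "a < L"
    show "\<forall>\<^sub>F t in at_top. a < f t"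
      using eventually_ge_at_top[of T] by eventually_elim (use ge \<open>a < L\<close> in force)
  next
    fix a assume "L < a"
    then obtain s where s: "s \<ge> T" "f s < a"
      using cInf_less_iff[OF _ bdd, of a] by (auto simp: L_def)
    show "\<forall>\<^sub>F t in at_top. f t < a"
      using eventually_ge_at_top[of s] by eventually_elim (use assms(1) s in force)
  qed
  thus ?thesis using \<open>L \<ge> c\<close> by blast
qed

section \<open>Logarithmic variables\<close>

lemma eventually_at_top_ge:
  fixes T :: real
  assumes "eventually P at_top"
  obtains S where "S \<ge> T" "\<And>t. t \<ge> S \<Longrightarrow> P t"
proof -
  have "\<forall>\<^sub>F t in at_top. P t \<and> t \<ge> T"
    using assms eventually_ge_at_top by (rule eventually_conj)
  then obtain S where "\<forall>t\<ge>S. P t \<and> t \<ge> T" by (auto simp: eventually_at_top_linorder)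
  thus ?thesis using that by blast
qed

text \<open>\<open>g\<close> is the solution, up to sign, as a function of t = ln r. The relation g'
  = - g / x encodes x = w / (r |w'|) for decreasing positive w. \<open>x_deriv_raw\<close> is (E)
  with v written out, because v receives its name only inside the locale.\<close>

locale log_orbit =
  fixes n p q \<alpha> T :: real and g x :: "real \<Rightarrow> real"
  assumes p_gt_1: "1 < p" and p_less_2: "p < 2" and q_gt_1: "1 < q"
    and \<alpha>_pos: "0 < \<alpha>" and \<alpha>_less: "\<alpha> < p / (2 - p)"
    and g_pos: "T \<le> t \<Longrightarrow> 0 < g t" and x_pos: "T \<le> t \<Longrightarrow> 0 < x t"
    and g_deriv: "T \<le> t \<Longrightarrow> (g has_real_derivative - g t / x t) (at t)"
    and x_deriv_raw: "T \<le> t \<Longrightarrow> (x has_real_derivative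
      - 1 + (n - p) / (p - 1) * x t + (1 - (\<alpha> + g t powr (q - 1)) * x t)
        / ((p - 1) * (x t powr (1 - p) * g t powr (p - 2) * exp (- p * t)))) (at t)"
    and decay: "((\<lambda>t. exp (\<alpha> * t) * g t) \<longlongrightarrow> 0) at_top"
begin

definition "\<delta> = p / (2 - p)"
definition "\<eta> = (n - p) / (p - 1)"
definition "e t = g t powr (q - 1)"
text \<open>This is |w'|^(p-1) / (r w) after inserting |w'| = w / (r x) and r = exp t.\<close>

definition "v t = x t powr (1 - p) * g t powr (p - 2) * exp (- p * t)"
definition "y t = exp (\<delta> * t) * g t"
text \<open>Velocity of x with \<epsilon> in place of e and k in place of y^(2-p), so that both can
  be frozen in comparisons.\<close>

definition "\<Phi> \<epsilon> k z = - 1 + \<eta> * z + (1 - (\<alpha> + \<epsilon>) * z) * z powr (p - 1) * k / (p - 1)"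

lemma \<delta>_pos: "0 < \<delta>" and \<delta>_eq: "\<delta> * (2 - p) = p" and \<alpha>_less_\<delta>: "\<alpha> < \<delta>"
  using p_gt_1 p_less_2 \<alpha>_less by (auto simp: \<delta>_def)

lemma \<eta>_eq: "\<eta> = \<delta> + (n - \<delta>) / (p - 1)"
  using p_gt_1 \<delta>_eq by (simp add: \<eta>_def field_simps)

lemma e_pos: "T \<le> t \<Longrightarrow> 0 < e t" and v_pos: "T \<le> t \<Longrightarrow> 0 < v t" and y_pos: "T \<le> t \<Longrightarrow> 0 < y t"
  using g_pos[of t] x_pos[of t] by (auto simp: e_def v_def y_def)

text \<open>Because \<delta> (2 - p) = p, the explicit factor exp (p t) is absorbed into y. The
  system for x and y is then autonomous apart from e.\<close>

lemma inverse_v: 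
  assumes "T \<le> t" shows "1 / v t = x t powr (p - 1) * y t powr (2 - p)"
proof -
  have "exp (\<delta> * t) powr (2 - p) = exp (p * t)"
    using \<delta>_eq by (simp add: exp_powr_real mult.commute mult.left_commute)
  hence "v t * (x t powr (p - 1) * y t powr (2 - p)) = 
      (x t powr (1 - p) * x t powr (p - 1)) * (g t powr (p - 2) * g t powr (2 - p)) * (exp (- p * t) * exp (p * t))"
    using g_pos[OF assms] by (simp add: v_def y_def powr_mult)
  also have "\<dots> = 1"
    using g_pos[OF assms] x_pos[OF assms] by (simp flip: powr_add exp_add)
  finally show ?thesis using v_pos[OF assms] by (simp add: field_simps)
qed

lemma x_deriv_v: 
  assumes "T \<le> t" 
  shows "(x has_real_derivative - 1 + \<eta> * x t + (1 - (\<alpha> + e t) * x t) / ((p - 1) * v t)) (at t)"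
  using x_deriv_raw[OF assms] by (simp add: \<eta>_def e_def v_def)

lemma x_deriv: 
  assumes "T \<le> t" shows "(x has_real_derivative \<Phi> (e t) (y t powr (2 - p)) (x t)) (at t)"
proof -
  have "(1 - (\<alpha> + e t) * x t) / ((p - 1) * v t) = (1 - (\<alpha> + e t) * x t) * (1 / v t) / (p - 1)"
    by simp
  thus ?thesis using x_deriv_v[OF assms] unfolding inverse_v[OF assms] \<Phi>_def
    by (simp add: mult.assoc)
qed

text \<open>As v is a product of powers, v'/v = (1 - p) x'/x + (p - 2) g'/g - p. The part of x' that
  carries 1/v yields the summand free of v, so the result is linear in v for given x.\<close>

lemma v_deriv:
  assumes "T \<le> t"
  shows "(v has_real_derivative v t * (1 / x t - n) - (1 / x t - \<alpha> - e t)) (at t)"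
proof -
  note pos = g_pos[OF assms] x_pos[OF assms] v_pos[OF assms]
  let ?x' = "- 1 + \<eta> * x t + (1 - (\<alpha> + e t) * x t) / ((p - 1) * v t)"
  have px: "x t powr (1 - p - 1) = x t powr (1 - p) / x t"
    using pos by (subst powr_diff) simp_all
  have pg: "g t powr (p - 2 - 1) = g t powr (p - 2) / g t"
    using pos by (subst powr_diff) simp_all
  have "(v has_real_derivative 
      ((1 - p) * x t powr (1 - p - 1) * ?x') * g t powr (p - 2) * exp (- p * t)
      + ((p - 2) * g t powr (p - 2 - 1) * (- g t / x t)) * x t powr (1 - p) * exp (- p * t)
      + x t powr (1 - p) * g t powr (p - 2) * (- p * exp (- p * t))) (at t)"
    unfolding v_def[abs_def]
    by (rule derivative_eq_intros refl DERIV_fun_powr x_deriv_v[OF assms] g_deriv[OF assms] pos)+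
       (simp add: algebra_simps v_def)
  also have "((1 - p) * x t powr (1 - p - 1) * ?x') * g t powr (p - 2) * exp (- p * t)
      + ((p - 2) * g t powr (p - 2 - 1) * (- g t / x t)) * x t powr (1 - p) * exp (- p * t)
      + x t powr (1 - p) * g t powr (p - 2) * (- p * exp (- p * t))
      = v t * ((1 - p) * ?x' / x t - (p - 2) / x t - p)"
    unfolding px pg v_def using pos by (simp add: field_simps)
  also have "\<dots> = v t * (1 / x t - n) - (1 / x t - \<alpha> - e t)"
  proof -
    let ?B = "1 - (\<alpha> + e t) * x t"
    have 1: "(1 - p) * (?B / ((p - 1) * v t)) = - (?B / v t)"
    proof -
      have "(1 - p) * (?B / ((p - 1) * v t)) = - ((p - 1) * (?B / ((p - 1) * v t)))" by algebra
      also have "(p - 1) * (?B / ((p - 1) * v t)) = ?B / v t" using p_gt_1 by simp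
      finally show ?thesis .
    qed
    have 2: "(1 - p) * (\<eta> * x t) = - (n - p) * x t" 
      using p_gt_1 by (simp add: \<eta>_def field_simps)
    have 3: "(1 - p) * ?x' = (p - 1) - (n - p) * x t - ?B / v t"
      unfolding distrib_left 1 2 by (simp add: algebra_simps)
    show ?thesis unfolding 3 using pos by (simp add: field_simps)
  qed
  finally show ?thesis .
qed

lemma y_deriv: "T \<le> t \<Longrightarrow> (y has_real_derivative (\<delta> - 1 / x t) * y t) (at t)"
  unfolding y_def[abs_def]
  by (rule derivative_eq_intros refl g_deriv | assumption)+ (simp add: algebra_simps)

text \<open>The decay hypothesis gives g <= exp (- \<alpha> t) at late times; the power q - 1 > 0
  preserves this.\<close>

lemma e_le: obtains S where "S \<ge> T" "\<And>t. t \<ge> S \<Longrightarrow> e t \<le> exp (- (\<alpha> * (q - 1)) * t)"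
proof -
  have "\<forall>\<^sub>F t in at_top. exp (\<alpha> * t) * g t < 1" using decay by (rule order_tendstoD) simp
  then obtain S where S: "S \<ge> T" "\<And>t. t \<ge> S \<Longrightarrow> exp (\<alpha> * t) * g t < 1"
    by (rule eventually_at_top_ge[where T = T]) blast 
  have "e t \<le> exp (- (\<alpha> * (q - 1)) * t)" if "t \<ge> S" for t
  proof -
    have "g t \<le> exp (- (\<alpha> * t))" using S(2)[OF that] by (simp add: exp_minus field_simps)
    hence "e t \<le> exp (- (\<alpha> * t)) powr (q - 1)"
      unfolding e_def using g_pos[of t] q_gt_1 S(1) that by (intro powr_mono2) auto
    thus ?thesis by (simp add: exp_powr_real algebra_simps)
  qed
  thus ?thesis using S(1) that by blast
qed

lemma e_tendsto: "(e \<longlongrightarrow> 0) at_top"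
proof -
  obtain S where S: "S \<ge> T" "\<And>t. t \<ge> S \<Longrightarrow> e t \<le> exp (- (\<alpha> * (q - 1)) * t)" using e_le by blast
  define k where "k = \<alpha> * (q - 1)"
  have "k > 0" using \<alpha>_pos q_gt_1 by (simp add: k_def)
  have lim: "((\<lambda>t. exp (- k * t)) \<longlongrightarrow> 0) at_top" using \<open>k > 0\<close> by real_asymp
  have "\<forall>\<^sub>F t in at_top. e t \<le> exp (- k * t)"
    using eventually_ge_at_top[of S] by eventually_elim (use S(2) in \<open>simp add: k_def\<close>)
  moreover have "\<forall>\<^sub>F t in at_top. 0 \<le> e t" by (simp add: e_def)
  ultimately show ?thesis using tendsto_sandwich[OF _ _ tendsto_const lim] by simp
qed

text \<open>Such bounds would keep \<open>r\<^sup>\<alpha> w (1 - v)\<close> away from \<open>0\<close>, as for solutions of the slow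
  type \<open>w \<sim> c r\<^sup>-\<^sup>\<alpha>\<close>.\<close>

lemma no_slow_decay:
  assumes "S \<ge> T" "\<theta> < 1" "\<kappa> > 0" "C \<ge> 0" and v_le: "\<And>t. t \<ge> S \<Longrightarrow> v t \<le> \<theta>" 
    and ge: "\<And>t. t \<ge> S \<Longrightarrow> - C * exp (- \<kappa> * t) \<le> (n - \<alpha>) * v t - e t"
  shows False
proof -
  \<comment> \<open>The terms in 1/x cancel in the derivative of J, leaving exp (\<alpha> t) g ((n -
    \<alpha>) v - e).\<close>
  define J where "J t = exp (\<alpha> * t) * g t * (1 - v t)" for t
  have "\<exists>c>0. \<forall>t\<ge>S. c \<le> J t"
  proof (rule lower_bound_of_integrable_decay)
    fix t assume "S \<le> t"
    hence "T \<le> t" using \<open>S \<ge> T\<close> by simp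
    note pos = g_pos[OF this] x_pos[OF this]
    show "(J has_real_derivative exp (\<alpha> * t) * g t * ((n - \<alpha>) * v t - e t)) (at t)"
      unfolding J_def[abs_def]
      by (rule derivative_eq_intros refl g_deriv[OF \<open>T \<le> t\<close>] v_deriv[OF \<open>T \<le> t\<close>])+
        (use pos in \<open>simp add: field_simps\<close>)
    \<comment> \<open>This factor of at least 1 turns the exponentially small error into an
      exponentially small multiple of J.\<close>
    have "1 \<le> (1 - v t) / (1 - \<theta>)" using v_le[OF \<open>S \<le> t\<close>] \<open>\<theta> < 1\<close> by simp
    hence "C * exp (- \<kappa> * t) * 1 \<le> C * exp (- \<kappa> * t) * ((1 - v t) / (1 - \<theta>))"
      using \<open>C \<ge> 0\<close> by (intro mult_left_mono) auto
    with ge[OF \<open>S \<le> t\<close>] have "- (C * exp (- \<kappa> * t) * ((1 - v t) / (1 - \<theta>))) \<le> (n - \<alpha>) * v t - e t"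
      by simp
    hence "exp (\<alpha> * t) * g t * - (C * exp (- \<kappa> * t) * ((1 - v t) / (1 - \<theta>)))
        \<le> exp (\<alpha> * t) * g t * ((n - \<alpha>) * v t - e t)"
      using pos by (intro mult_left_mono) auto
    thus "- (C / (1 - \<theta>)) * exp (- \<kappa> * t) * J t \<le> exp (\<alpha> * t) * g t * ((n - \<alpha>) * v t - e t)"
      by (simp add: J_def mult.commute mult.left_commute)
  next
    show "J S > 0" using v_le[of S] g_pos[of S] assms(1,2) by (simp add: J_def)
  qed (use assms in auto)
  then obtain c where c: "c > 0" "\<And>t. t \<ge> S \<Longrightarrow> c \<le> J t" by blast
  have "\<forall>\<^sub>F t in at_top. exp (\<alpha> * t) * g t < c" using decay c(1) by (rule order_tendstoD)
  then obtain S' where S': "S' \<ge> S" "\<And>t. t \<ge> S' \<Longrightarrow> exp (\<alpha> * t) * g t < c"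
    by (rule eventually_at_top_ge[where T = S]) blast
  have "T \<le> S'" using S' assms by simp
  have "J S' \<le> exp (\<alpha> * S') * g S' * 1"
    unfolding J_def using v_pos[OF \<open>T \<le> S'\<close>] g_pos[OF \<open>T \<le> S'\<close>] by (intro mult_left_mono) auto
  thus False using c(2)[of S'] S' by force
qed

section \<open>Sign of the velocity of x on vertical strips\<close>

lemma continuous_\<Phi>: "z > 0 \<Longrightarrow> isCont (\<Phi> \<epsilon> k) z"
  unfolding \<Phi>_def[abs_def] using p_gt_1 by (intro continuous_intros) auto

text \<open>Continuity at \<open>z\<^sub>0\<close> suffices. The sign \<sigma> serves both crossing
  directions, and the bound on (\<alpha> + \<epsilon>) z is carried along because the monotonicity
  of \<Phi> relies on it.\<close>

lemma \<Phi>_strip: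
  assumes "\<sigma> * \<Phi> \<epsilon> k z\<^sub>0 > 0" "(\<alpha> + \<epsilon>) * z\<^sub>0 < 1" "z\<^sub>0 > 0"
  obtains c d where "c > 0" "d > 0" "d < z\<^sub>0"
    "\<And>z. z\<^sub>0 - d \<le> z \<Longrightarrow> z \<le> z\<^sub>0 + d \<Longrightarrow> (\<alpha> + \<epsilon>) * z < 1 \<and> \<sigma> * \<Phi> \<epsilon> k z \<ge> c"
proof -
  define c where "c = \<sigma> * \<Phi> \<epsilon> k z\<^sub>0 / 2"
  have c: "c > 0" "c < \<sigma> * \<Phi> \<epsilon> k z\<^sub>0" using assms by (auto simp: c_def)
  have "((\<lambda>z. \<sigma> * \<Phi> \<epsilon> k z) \<longlongrightarrow> \<sigma> * \<Phi> \<epsilon> k z\<^sub>0) (nhds z\<^sub>0)"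
    using continuous_\<Phi>[OF \<open>z\<^sub>0 > 0\<close>] by (intro tendsto_intros) (simp add: tendsto_nhds_iff isCont_def)
  hence "\<forall>\<^sub>F z in nhds z\<^sub>0. c < \<sigma> * \<Phi> \<epsilon> k z" using c(2) by (rule order_tendstoD)
  moreover have "((\<lambda>z. (\<alpha> + \<epsilon>) * z) \<longlongrightarrow> (\<alpha> + \<epsilon>) * z\<^sub>0) (nhds z\<^sub>0)"
    by (intro tendsto_intros) (simp add: filterlim_ident)
  hence "\<forall>\<^sub>F z in nhds z\<^sub>0. (\<alpha> + \<epsilon>) * z < 1" using assms(2) by (rule order_tendstoD)
  ultimately have "\<forall>\<^sub>F z in nhds z\<^sub>0. (\<alpha> + \<epsilon>) * z < 1 \<and> \<sigma> * \<Phi> \<epsilon> k z \<ge> c"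
    by eventually_elim auto
  then obtain d where d: "d > 0" "\<And>z. dist z z\<^sub>0 < d \<Longrightarrow> (\<alpha> + \<epsilon>) * z < 1 \<and> \<sigma> * \<Phi> \<epsilon> k z \<ge> c"
    by (auto simp: eventually_nhds_metric)
  show ?thesis
    by (rule that[of c "min (d / 2) (z\<^sub>0 / 2)"])
      (use d c(1) assms(3) in \<open>auto simp: dist_real_def abs_less_iff min_def split: if_splits\<close>)
qed

end

section \<open>The saddle point\<close>

context log_orbit
begin

text \<open>The prefactor is positive, so on the line x = 1/\<delta>, where y is stationary, the
  sign of the velocity of x is that of k minus an explicit constant. For n < \<delta> this constant
  is l^(2-p), which locates the equilibrium.\<close>

lemma \<Phi>_at_inverse_\<delta>:
  "\<Phi> 0 k (1 / \<delta>) = (1 - \<alpha> / \<delta>) * (1 / \<delta>) powr (p - 1) * 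
     (k - \<delta> powr (p - 1) * ((\<delta> - n) / (\<delta> - \<alpha>))) / (p - 1)"
proof -
  have 1: "(1 / \<delta>) powr (p - 1) * \<delta> powr (p - 1) = 1"
    using \<delta>_pos by (simp flip: powr_mult)
  have "(1 - \<alpha> / \<delta>) * (1 / \<delta>) powr (p - 1) * (\<delta> powr (p - 1) * ((\<delta> - n) / (\<delta> - \<alpha>)))
      = ((1 - \<alpha> / \<delta>) * ((\<delta> - n) / (\<delta> - \<alpha>))) * ((1 / \<delta>) powr (p - 1) * \<delta> powr (p - 1))"
    by (simp only: mult_ac)
  also have "\<dots> = (\<delta> - n) / \<delta>"
    unfolding 1 using \<delta>_pos \<alpha>_less_\<delta> by (simp add: field_simps)
  finally have 2: "(1 - \<alpha> / \<delta>) * (1 / \<delta>) powr (p - 1) * (\<delta> powr (p - 1) * ((\<delta> - n) / (\<delta> - \<alpha>)))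
      = (\<delta> - n) / \<delta>" .
  have 3: "- 1 + \<eta> * (1 / \<delta>) = - ((\<delta> - n) / \<delta>) / (p - 1)"
    using \<delta>_pos p_gt_1 unfolding \<eta>_eq by (simp add: field_simps)
  show ?thesis
    unfolding \<Phi>_def right_diff_distrib 2 3 by (simp add: diff_divide_distrib)
qed

text \<open>Used to replace the unknown e and y^(2-p) by constants; the bracket that multiplies k is
  nonnegative for the smaller parameter \<epsilon>'.\<close>

lemma \<Phi>_mono:
  assumes "\<epsilon>' \<le> \<epsilon>" "(\<alpha> + \<epsilon>') * z \<le> 1" "z > 0" "0 \<le> k" "k \<le> k'"
  shows "\<Phi> \<epsilon> k z \<le> \<Phi> \<epsilon>' k' z"
proof -
  have "(\<alpha> + \<epsilon>') * z \<le> (\<alpha> + \<epsilon>) * z" using assms by (intro mult_right_mono) auto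
  hence "(1 - (\<alpha> + \<epsilon>) * z) * z powr (p - 1) * k \<le> (1 - (\<alpha> + \<epsilon>') * z) * z powr (p - 1) * k"
    using assms by (intro mult_right_mono) auto
  also have "\<dots> \<le> (1 - (\<alpha> + \<epsilon>') * z) * z powr (p - 1) * k'"
    using assms by (intro mult_left_mono) auto
  finally show ?thesis unfolding \<Phi>_def using p_gt_1 by (simp add: divide_right_mono)
qed

lemma y_tendsto_0:
  assumes "S \<ge> T" "0 < b" "b < 1 / \<delta>" "\<And>t. t \<ge> S \<Longrightarrow> x t \<le> b"
  shows "(y \<longlongrightarrow> 0) at_top"
proof -
  define c where "c = 1 / b - \<delta>"
  have "c > 0" using assms \<delta>_pos by (simp add: c_def field_simps)
  have le: "y t \<le> y S * exp (- c * (t - S))" if "t \<ge> S" for t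
  proof -
    \<comment> \<open>Here x <= b makes the relative rate \<delta> - 1/x of y at most - c, so the
      growth lemma is applied to - y.\<close>
    have "- y S * exp (- c * (t - S)) \<le> - y t"
    proof (rule exp_growth)
      fix s assume "S \<le> s"
      hence "T \<le> s" using assms by simp
      show "((\<lambda>t. - y t) has_real_derivative - ((\<delta> - 1 / x s) * y s)) (at s)"
        by (rule DERIV_minus[OF y_deriv[OF \<open>T \<le> s\<close>]])
      have "1 / b \<le> 1 / x s"
        using assms(4)[OF \<open>S \<le> s\<close>] x_pos[OF \<open>T \<le> s\<close>] by (simp add: frac_le)
      hence "c * y s \<le> (1 / x s - \<delta>) * y s"
        using y_pos[OF \<open>T \<le> s\<close>] by (intro mult_right_mono) (auto simp: c_def)
      thus "- c * - y s \<le> - ((\<delta> - 1 / x s) * y s)" by (simp add: algebra_simps)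
    qed (use that in auto)
    thus ?thesis by simp
  qed
  show ?thesis
  proof (rule tendsto_sandwich)
    show "\<forall>\<^sub>F t in at_top. 0 \<le> y t"
      using eventually_ge_at_top[of T] by eventually_elim (use y_pos in force)
    show "\<forall>\<^sub>F t in at_top. y t \<le> y S * exp (- c * (t - S))"
      using eventually_ge_at_top[of S] by eventually_elim (rule le)
    have "((\<lambda>t. exp (- c * (t - S))) \<longlongrightarrow> 0) at_top" using \<open>c > 0\<close> by real_asymp
    thus "((\<lambda>t. y S * exp (- c * (t - S))) \<longlongrightarrow> 0) at_top" by (rule tendsto_mult_right_zero)
  qed simp
qed

lemma y_growth:
  assumes "S \<ge> T" "1 / \<delta> < b" "\<And>t. t \<ge> S \<Longrightarrow> b \<le> x t" "t \<ge> S"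
  shows "y S * exp ((\<delta> - 1 / b) * (t - S)) \<le> y t"
proof (rule exp_growth)
  fix s assume "S \<le> s"
  hence "T \<le> s" using assms by simp
  show "(y has_real_derivative (\<delta> - 1 / x s) * y s) (at s)" by (rule y_deriv[OF \<open>T \<le> s\<close>])
  have "b > 0" using assms(2) \<delta>_pos by (smt (verit) divide_pos_pos)
  hence "1 / x s \<le> 1 / b" using assms(3)[OF \<open>S \<le> s\<close>] by (simp add: frac_le)
  thus "(\<delta> - 1 / b) * y s \<le> (\<delta> - 1 / x s) * y s"
    using y_pos[OF \<open>T \<le> s\<close>] by (intro mult_right_mono) auto
qed (use assms in auto)

lemma y_at_top:
  assumes "S \<ge> T" "1 / \<delta> < b" "\<And>t. t \<ge> S \<Longrightarrow> b \<le> x t"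
  shows "filterlim y at_top at_top"
proof (rule filterlim_at_top_mono)
  show "\<forall>\<^sub>F t in at_top. y S * exp ((\<delta> - 1 / b) * (t - S)) \<le> y t"
    using eventually_ge_at_top[of S] by eventually_elim (use y_growth[OF assms] in auto)
  have "b > 0" using assms(2) \<delta>_pos by (smt (verit) divide_pos_pos)
  define c where "c = \<delta> - 1 / b"
  have "c > 0" using assms(2) \<delta>_pos \<open>b > 0\<close> by (simp add: c_def field_simps)
  hence "filterlim (\<lambda>t. exp (c * (t - S))) at_top at_top" by real_asymp
  thus "filterlim (\<lambda>t. y S * exp ((\<delta> - 1 / b) * (t - S))) at_top at_top"
    unfolding c_def by (rule filterlim_tendsto_pos_mult_at_top[OF tendsto_const y_pos[OF \<open>S \<ge> T\<close>]])
qed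

end

section \<open>The case N < \<delta>: convergence to the saddle point\<close>

locale log_orbit_supercritical = log_orbit +
  fixes l :: real
  assumes n_less_\<delta>: "n < \<delta>" and l_pos: "l > 0"
    and l_eq: "l powr (2 - p) = \<delta> powr (p - 1) * ((\<delta> - n) / (\<delta> - \<alpha>))"
begin

lemma \<Phi>_inverse_\<delta>_neg: "0 < a \<Longrightarrow> a < l \<Longrightarrow> \<Phi> 0 (a powr (2 - p)) (1 / \<delta>) < 0"
  and \<Phi>_inverse_\<delta>_pos: "l < a \<Longrightarrow> 0 < \<Phi> 0 (a powr (2 - p)) (1 / \<delta>)"
  unfolding \<Phi>_at_inverse_\<delta> l_eq[symmetric]
  using p_gt_1 p_less_2 \<delta>_pos \<alpha>_less_\<delta> l_pos
  by (auto intro!: divide_neg_pos mult_pos_neg mult_pos_pos divide_pos_pos powr_less_mono2)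

lemma \<eta>_less_\<delta>: "\<eta> < \<delta>"
  unfolding \<eta>_eq using n_less_\<delta> p_gt_1 by (simp add: divide_neg_pos)

text \<open>With y <= a < l the velocity of x is negative near 1/\<delta>, so x stays to one side of
  a strip. On the right y tends to infinity. On the left y tends to 0, the last term of \<Phi> dies
  out, and x reaches 0 in finite time.\<close>

lemma y_not_eventually_le:
  assumes "0 < a" "a < l" "S \<ge> T" "\<And>t. t \<ge> S \<Longrightarrow> y t \<le> a"
  shows False
proof -
  let ?k = "a powr (2 - p)" and ?X = "1 / \<delta>"
  have "?X > 0" using \<delta>_pos by simp
  have "(\<alpha> + 0) * ?X < 1" using \<alpha>_less_\<delta> \<delta>_pos by (simp add: field_simps)
  moreover have "-1 * \<Phi> 0 ?k ?X > 0" using \<Phi>_inverse_\<delta>_neg assms by simp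
  ultimately obtain c d where cd: "c > 0" "d > 0" "d < ?X"
    "\<And>z. ?X - d \<le> z \<Longrightarrow> z \<le> ?X + d \<Longrightarrow> (\<alpha> + 0) * z < 1 \<and> -1 * \<Phi> 0 ?k z \<ge> c"
    using \<Phi>_strip[of "-1" 0 ?k ?X] \<open>?X > 0\<close> by metis
  have "(\<forall>t\<ge>S. ?X + d \<le> x t) \<or> (\<exists>S'\<ge>S. \<forall>t\<ge>S'. x t \<le> ?X - d)"
  proof (rule strip_dichotomy[OF x_deriv])
    fix t assume t: "S \<le> t" "?X - d \<le> x t" "x t \<le> ?X + d"
    hence "T \<le> t" using assms by simp
    have "\<Phi> (e t) (y t powr (2 - p)) (x t) \<le> \<Phi> 0 ?k (x t)"
      using cd(4)[OF t(2,3)] e_pos[OF \<open>T \<le> t\<close>] x_pos[OF \<open>T \<le> t\<close>] y_pos[OF \<open>T \<le> t\<close>]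
        assms(4)[OF t(1)] p_less_2
      by (intro \<Phi>_mono powr_mono2) auto
    thus "\<Phi> (e t) (y t powr (2 - p)) (x t) \<le> - c" using cd(4)[OF t(2,3)] by simp
  qed (use assms cd in auto)
  thus False
  proof
    assume "\<forall>t\<ge>S. ?X + d \<le> x t"
    hence "filterlim y at_top at_top"
      by (intro y_at_top[OF \<open>S \<ge> T\<close>, of "?X + d"]) (use cd in auto)
    hence "\<forall>\<^sub>F t in at_top. a < y t" by (simp add: filterlim_at_top_dense)
    then obtain t where "t \<ge> S" "a < y t" by (rule eventually_at_top_ge[where T = S]) blast
    thus False using assms(4)[of t] by simp
  next
    assume "\<exists>S'\<ge>S. \<forall>t\<ge>S'. x t \<le> ?X - d"
    then obtain S' where S': "S' \<ge> S" "\<And>t. t \<ge> S' \<Longrightarrow> x t \<le> ?X - d" by blast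
    have "S' \<ge> T" using S' assms by simp
    have "(y \<longlongrightarrow> 0) at_top"
      by (rule y_tendsto_0[OF \<open>S' \<ge> T\<close> _ _ S'(2)]) (use cd in auto)
    hence "((\<lambda>t. y t powr (2 - p)) \<longlongrightarrow> 0) at_top"
      using p_less_2 y_pos by (intro tendsto_zero_powrI[OF _ tendsto_const])
        (auto intro!: eventually_at_top_linorderI[of T] less_imp_le)
    hence lim: "((\<lambda>t. ?X powr (p - 1) * y t powr (2 - p) / (p - 1)) \<longlongrightarrow> 0) at_top"
      by (intro tendsto_divide_zero tendsto_mult_right_zero)
    \<comment> \<open>m bounds \<eta> x for 0 < x <= 1/\<delta>, whatever the sign of \<eta>, and m
      < 1 since \<eta> < \<delta>. Half of the gap 1 - m absorbs the vanishing term.\<close>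
    define m where "m = max 0 (\<eta> * ?X)"
    have "\<eta> * ?X < 1" using \<eta>_less_\<delta> \<delta>_pos by (simp add: field_simps)
    hence "m < 1" by (simp add: m_def)
    have "\<forall>\<^sub>F t in at_top. ?X powr (p - 1) * y t powr (2 - p) / (p - 1) < (1 - m) / 2"
      using \<open>m < 1\<close> by (intro order_tendstoD[OF lim]) auto
    then obtain S'' where S'': "S'' \<ge> S'" 
      "\<And>t. t \<ge> S'' \<Longrightarrow> ?X powr (p - 1) * y t powr (2 - p) / (p - 1) < (1 - m) / 2"
      by (rule eventually_at_top_ge[where T = S']) blast
    have "\<exists>U\<ge>S''. \<forall>t\<ge>U. x t \<le> 0"
    proof (rule eventually_le_of_deriv[OF x_deriv])
      fix t assume t: "S'' \<le> t"
      hence "T \<le> t" "S' \<le> t" using S'' S' \<open>S' \<ge> T\<close> by auto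
      have xX: "x t \<le> ?X" using S'(2)[OF \<open>S' \<le> t\<close>] cd by simp
      have "x t > 0" using x_pos[OF \<open>T \<le> t\<close>] .
      have "\<eta> * x t \<le> m"
      proof (cases "\<eta> \<ge> 0")
        case True
        hence "\<eta> * x t \<le> \<eta> * ?X" using xX by (intro mult_left_mono)
        thus ?thesis by (simp add: m_def)
      next
        case False
        hence "\<eta> * x t \<le> 0" using \<open>x t > 0\<close> by (intro mult_nonpos_nonneg) auto
        thus ?thesis by (simp add: m_def)
      qed
      moreover have "(1 - (\<alpha> + e t) * x t) * x t powr (p - 1) * y t powr (2 - p) / (p - 1)
         \<le> 1 * ?X powr (p - 1) * y t powr (2 - p) / (p - 1)"
        using p_gt_1 xX \<open>x t > 0\<close> e_pos[OF \<open>T \<le> t\<close>] \<alpha>_pos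
        by (intro divide_right_mono mult_right_mono mult_mono powr_mono2) auto
      moreover have "- 1 + a + b \<le> - ((1 - m) / 2)" if "a \<le> m" "b \<le> c" "c < (1 - m) / 2" for a b c
        using that by (simp add: field_simps)
      ultimately show "\<Phi> (e t) (y t powr (2 - p)) (x t) \<le> - ((1 - m) / 2)"
        using S''(2)[OF t] unfolding \<Phi>_def mult_1_left by blast
    qed (use S'' S' assms \<open>m < 1\<close> in auto)
    then obtain U where "U \<ge> S''" "x U \<le> 0" by blast
    thus False using x_pos[of U] S'' S' assms(3) by simp
  qed
qed

text \<open>With y >= a > l the velocity of x is positive near 1/\<delta>. If x stays on the left, y
  tends to 0. If it passes to the right, y grows exponentially, so v decays exponentially, and this
  is excluded by \<open>no_slow_decay\<close>.\<close>

lemma y_not_eventually_ge: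
  assumes "l < a" "S \<ge> T" "\<And>t. t \<ge> S \<Longrightarrow> a \<le> y t"
  shows False
proof -
  let ?k = "a powr (2 - p)" and ?X = "1 / \<delta>"
  have "?X > 0" "a > 0" using \<delta>_pos l_pos assms by auto
  \<comment> \<open>Positivity at \<epsilon> = 0 is too weak, because e > 0 lowers \<Phi>. A small
    positive \<epsilon> that later dominates e keeps the sign.\<close>
  have "((\<lambda>\<epsilon>. \<Phi> \<epsilon> ?k ?X) \<longlongrightarrow> \<Phi> 0 ?k ?X) (at_right 0)"
    unfolding \<Phi>_def using p_gt_1 by (intro tendsto_intros) auto
  hence "\<forall>\<^sub>F \<epsilon> in at_right 0. \<Phi> \<epsilon> ?k ?X > 0" 
    using \<Phi>_inverse_\<delta>_pos[OF \<open>l < a\<close>] by (rule order_tendstoD)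
  moreover have "((\<lambda>\<epsilon>. (\<alpha> + \<epsilon>) * ?X) \<longlongrightarrow> (\<alpha> + 0) * ?X) (at_right 0)"
    by (intro tendsto_intros)
  hence "\<forall>\<^sub>F \<epsilon> in at_right 0. (\<alpha> + \<epsilon>) * ?X < 1" 
    by (rule order_tendstoD) (use \<alpha>_less_\<delta> \<delta>_pos in \<open>simp add: field_simps\<close>)
  moreover have "\<forall>\<^sub>F \<epsilon>::real in at_right 0. \<epsilon> > 0" by (rule eventually_at_right_less)
  ultimately have "\<forall>\<^sub>F \<epsilon> in at_right 0. \<Phi> \<epsilon> ?k ?X > 0 \<and> (\<alpha> + \<epsilon>) * ?X < 1 \<and> \<epsilon> > 0"
    by eventually_elim blast
  then obtain \<epsilon> where \<epsilon>: "1 * \<Phi> \<epsilon> ?k ?X > 0" "(\<alpha> + \<epsilon>) * ?X < 1" "\<epsilon> > 0"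
    using eventually_happens'[OF trivial_limit_at_right_real] by (metis (lifting) mult_1)
  obtain c d where cd: "c > 0" "d > 0" "d < ?X"
    "\<And>z. ?X - d \<le> z \<Longrightarrow> z \<le> ?X + d \<Longrightarrow> (\<alpha> + \<epsilon>) * z < 1 \<and> 1 * \<Phi> \<epsilon> ?k z \<ge> c"
    using \<Phi>_strip[OF \<epsilon>(1,2) \<open>?X > 0\<close>] by metis
  have "\<forall>\<^sub>F t in at_top. e t < \<epsilon>" using e_tendsto \<epsilon>(3) by (rule order_tendstoD)
  then obtain S' where S': "S' \<ge> S" "\<And>t. t \<ge> S' \<Longrightarrow> e t < \<epsilon>"
    by (rule eventually_at_top_ge[where T = S]) blast
  \<comment> \<open>The passage is upwards here, so the dichotomy is applied to - x.\<close>
  have "(\<forall>t\<ge>S'. - (?X - d) \<le> - x t) \<or> (\<exists>S''\<ge>S'. \<forall>t\<ge>S''. - x t \<le> - (?X + d))"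
  proof (rule strip_dichotomy[OF DERIV_minus[OF x_deriv]])
    fix t assume t: "S' \<le> t" "- (?X + d) \<le> - x t" "- x t \<le> - (?X - d)"
    hence "T \<le> t" using assms S' by simp
    have x: "?X - d \<le> x t" "x t \<le> ?X + d" using t by auto
    have "(\<alpha> + e t) * x t \<le> (\<alpha> + \<epsilon>) * x t"
      using S'(2)[OF t(1)] x_pos[OF \<open>T \<le> t\<close>] by (intro mult_right_mono) auto
    hence "(\<alpha> + e t) * x t \<le> 1" using cd(4)[OF x] by simp
    hence "\<Phi> \<epsilon> ?k (x t) \<le> \<Phi> (e t) (y t powr (2 - p)) (x t)"
      using S'(2)[OF t(1)] x_pos[OF \<open>T \<le> t\<close>] y_pos[OF \<open>T \<le> t\<close>] assms(3)[of t] S'(1) t(1) p_less_2 \<open>a > 0\<close>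
      by (intro \<Phi>_mono powr_mono2) auto
    thus "- \<Phi> (e t) (y t powr (2 - p)) (x t) \<le> - c" using cd(4)[OF x] by simp
  qed (use assms S' cd in auto)
  thus False
  proof
    assume "\<forall>t\<ge>S'. - (?X - d) \<le> - x t"
    hence "(y \<longlongrightarrow> 0) at_top"
      by (intro y_tendsto_0[of S' "?X - d"]) (use cd assms(2) S'(1) in auto)
    hence "\<forall>\<^sub>F t in at_top. y t < a" using \<open>a > 0\<close> by (rule order_tendstoD)
    then obtain t where "t \<ge> S" "y t < a" by (rule eventually_at_top_ge[where T = S]) blast
    thus False using assms(3)[of t] by simp
  next
    assume "\<exists>S''\<ge>S'. \<forall>t\<ge>S''. - x t \<le> - (?X + d)"
    then obtain U where U: "U \<ge> S'" "\<And>t. t \<ge> U \<Longrightarrow> ?X + d \<le> x t" by force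
    have "U \<ge> T" using U S' assms by simp
    define c' where "c' = \<delta> - 1 / (?X + d)"
    have "c' > 0" using \<delta>_pos cd by (simp add: c'_def field_simps add_pos_pos)
    define \<kappa> where "\<kappa> = c' * (2 - p)"
    have "\<kappa> > 0" using \<open>c' > 0\<close> p_less_2 by (simp add: \<kappa>_def)
    \<comment> \<open>Chosen so that the growth of y from time \<open>U\<close> and x >= 1/\<delta>
      give 1/v >= exp (\<kappa> t) / C.\<close>
    define C where "C = exp (\<kappa> * U) / (?X powr (p - 1) * y U powr (2 - p))"
    have "C > 0" using y_pos[OF \<open>U \<ge> T\<close>] \<delta>_pos by (simp add: C_def)
    have v_le: "v t \<le> C * exp (- \<kappa> * t)" if "t \<ge> U" for t
    proof -
      have "T \<le> t" using that \<open>U \<ge> T\<close> by simp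
      have "y U * exp (c' * (t - U)) \<le> y t"
        unfolding c'_def by (rule y_growth[OF \<open>U \<ge> T\<close> _ U(2) that]) (use cd in auto)
      hence "(y U * exp (c' * (t - U))) powr (2 - p) \<le> y t powr (2 - p)"
        using p_less_2 y_pos[OF \<open>U \<ge> T\<close>] by (intro powr_mono2) auto
      moreover have "?X powr (p - 1) \<le> x t powr (p - 1)"
        using U(2)[OF that] cd \<open>?X > 0\<close> p_gt_1 by (intro powr_mono2) auto
      ultimately have "?X powr (p - 1) * (y U * exp (c' * (t - U))) powr (2 - p) \<le> 1 / v t"
        unfolding inverse_v[OF \<open>T \<le> t\<close>] by (intro mult_mono) auto
      moreover have "?X powr (p - 1) * (y U * exp (c' * (t - U))) powr (2 - p) = exp (\<kappa> * t) / C"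
      proof -
        have "exp (c' * (t - U)) powr (2 - p) = exp (\<kappa> * t - \<kappa> * U)"
          by (simp add: exp_powr_real \<kappa>_def algebra_simps)
        thus ?thesis using y_pos[OF \<open>U \<ge> T\<close>] by (simp add: C_def powr_mult exp_diff)
      qed
      ultimately have "exp (\<kappa> * t) / C \<le> 1 / v t" by simp
      thus ?thesis using \<open>C > 0\<close> v_pos[OF \<open>T \<le> t\<close>] by (simp add: exp_minus field_simps)
    qed
    obtain E where E: "E \<ge> T" "\<And>t. t \<ge> E \<Longrightarrow> e t \<le> exp (- (\<alpha> * (q - 1)) * t)" using e_le by blast
    have "((\<lambda>t. exp (- \<kappa> * t)) \<longlongrightarrow> 0) at_top" using \<open>\<kappa> > 0\<close> by real_asymp
    hence "((\<lambda>t. C * exp (- \<kappa> * t)) \<longlongrightarrow> 0) at_top" by (rule tendsto_mult_right_zero)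
    hence "\<forall>\<^sub>F t in at_top. C * exp (- \<kappa> * t) < 1 / 2" by (rule order_tendstoD) simp
    then obtain V where V: "V \<ge> max 0 (max U E)" "\<And>t. t \<ge> V \<Longrightarrow> C * exp (- \<kappa> * t) < 1 / 2"
      by (rule eventually_at_top_ge[where T = "max 0 (max U E)"]) blast
    \<comment> \<open>A common rate for v and e; \<open>V\<close> was taken nonnegative so that
      lowering the rate only enlarges the exponentials.\<close>
    define \<kappa>' where "\<kappa>' = min \<kappa> (\<alpha> * (q - 1))"
    show False
    proof (rule no_slow_decay[of V "1 / 2" \<kappa>' "\<bar>n - \<alpha>\<bar> * C + 1"])
      fix t assume t: "t \<ge> V"
      hence t': "t \<ge> 0" "t \<ge> U" "t \<ge> E" "t \<ge> T" using V \<open>U \<ge> T\<close> by auto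
      show "v t \<le> 1 / 2" using v_le[OF t'(2)] V(2)[OF t] by simp
      have le1: "exp (- \<kappa> * t) \<le> exp (- \<kappa>' * t)" "exp (- (\<alpha> * (q - 1)) * t) \<le> exp (- \<kappa>' * t)"
        using t'(1) by (auto simp: \<kappa>'_def intro!: mult_right_mono)
      have "v t \<le> C * exp (- \<kappa>' * t)" 
        using v_le[OF t'(2)] mult_left_mono[OF le1(1), of C] \<open>C > 0\<close> by linarith
      hence "\<bar>n - \<alpha>\<bar> * v t \<le> \<bar>n - \<alpha>\<bar> * (C * exp (- \<kappa>' * t))" by (intro mult_left_mono) auto
      moreover have "- (\<bar>n - \<alpha>\<bar> * v t) \<le> (n - \<alpha>) * v t"
        using v_pos[OF t'(4)] by (auto simp: abs_if algebra_simps)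
      moreover have "- (\<bar>n - \<alpha>\<bar> * C + 1) * exp (- \<kappa>' * t)
          = - (\<bar>n - \<alpha>\<bar> * (C * exp (- \<kappa>' * t))) - exp (- \<kappa>' * t)"
        by (simp add: algebra_simps)
      ultimately show "- (\<bar>n - \<alpha>\<bar> * C + 1) * exp (- \<kappa>' * t) \<le> (n - \<alpha>) * v t - e t"
        using E(2)[OF t'(3)] le1(2) by linarith
    qed (use V \<open>U \<ge> T\<close> \<open>\<kappa> > 0\<close> \<open>C > 0\<close> \<alpha>_pos q_gt_1 in \<open>auto simp: \<kappa>'_def\<close>)
  qed
qed

text \<open>The quadrants \<open>x \<le> 1 / \<delta>, y \<le> a < l\<close> and \<open>x \<ge> 1 / \<delta>, y \<ge> a > l\<close> at the saddle point
  \<open>(1 / \<delta>, l)\<close> are forward invariant, the second one at late times only. An orbit that entered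
  one of them would keep \<open>y\<close> away from \<open>l\<close>.\<close>

lemma eventually_y_ge:
  assumes "0 < a" "a < l"
  shows "\<forall>\<^sub>F t in at_top. a \<le> y t"
proof -
  let ?X = "1 / \<delta>"
  have x_gt: "x t > ?X" if "t \<ge> T" "y t \<le> a" for t
  proof (rule ccontr)
    assume "\<not> x t > ?X"
    \<comment> \<open>y is nonincreasing only while x <= 1/\<delta>. The barrier argument for x
      supplies exactly this up to the contact time, so the two bounds support each other.\<close>
    have y_le: "y s \<le> a" if "t \<le> s" "\<And>r. t \<le> r \<Longrightarrow> r \<le> s \<Longrightarrow> x r \<le> ?X" for s
    proof -
      have "y s \<le> y t"
      proof (rule DERIV_nonpos_imp_nonincreasing[OF \<open>t \<le> s\<close>])
        fix r assume r: "t \<le> r" "r \<le> s"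
        hence "T \<le> r" using \<open>t \<ge> T\<close> by simp
        have "(\<delta> - 1 / x r) * y r \<le> 0"
          using that(2)[OF r] x_pos[OF \<open>T \<le> r\<close>] y_pos[OF \<open>T \<le> r\<close>] \<delta>_pos
          by (intro mult_nonpos_nonneg) (auto simp: field_simps)
        thus "\<exists>D. (y has_real_derivative D) (at r) \<and> D \<le> 0" using y_deriv[OF \<open>T \<le> r\<close>] by blast
      qed
      thus ?thesis using \<open>y t \<le> a\<close> by simp
    qed
    have x_le: "x s \<le> ?X" if "t \<le> s" for s
    proof (rule barrier_le[OF x_deriv _ _ that])
      fix r assume r: "t \<le> r" "x r = ?X" "\<And>u. t \<le> u \<Longrightarrow> u \<le> r \<Longrightarrow> x u \<le> ?X"
      hence "T \<le> r" using \<open>t \<ge> T\<close> by simp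
      have "y r \<le> a" using y_le[OF r(1,3)] .
      moreover have "(\<alpha> + 0) * x r \<le> 1" unfolding r(2) using \<alpha>_less_\<delta> \<delta>_pos by (simp add: field_simps)
      ultimately have "\<Phi> (e r) (y r powr (2 - p)) (x r) \<le> \<Phi> 0 (a powr (2 - p)) (x r)"
        using e_pos[OF \<open>T \<le> r\<close>] x_pos[OF \<open>T \<le> r\<close>] y_pos[OF \<open>T \<le> r\<close>] p_less_2
        by (intro \<Phi>_mono powr_mono2) auto
      also have "\<dots> < 0" unfolding r(2) using \<Phi>_inverse_\<delta>_neg[OF assms] .
      finally show "\<Phi> (e r) (y r powr (2 - p)) (x r) < 0" .
    qed (use \<open>t \<ge> T\<close> \<open>\<not> x t > ?X\<close> in auto)
    show False
      by (rule y_not_eventually_le[OF assms \<open>t \<ge> T\<close>]) (use y_le x_le in auto)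
  qed
  obtain S where S: "S \<ge> T" "a \<le> y S"
    using y_not_eventually_le[OF assms order_refl] by force
  have "a \<le> y t" if "S \<le> t" for t
  \<comment> \<open>At a contact with level \<open>a\<close>, \<open>x_gt\<close> gives x >
    1/\<delta>, hence y increases there.\<close>
  proof (rule barrier_ge[OF y_deriv _ _ that])
    fix r assume r: "S \<le> r" "y r = a"
    hence "T \<le> r" using S by simp
    have "1 / x r < \<delta>" using x_gt[OF \<open>T \<le> r\<close>] r x_pos[OF \<open>T \<le> r\<close>] \<delta>_pos by (simp add: field_simps)
    thus "0 < (\<delta> - 1 / x r) * y r" using y_pos[OF \<open>T \<le> r\<close>] by simp
  qed (use S in auto)
  thus ?thesis by (rule eventually_at_top_linorderI)
qed

lemma eventually_y_le:
  assumes "l < a"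
  shows "\<forall>\<^sub>F t in at_top. y t \<le> a"
proof -
  let ?X = "1 / \<delta>"
  have "a > 0" using l_pos assms by simp
  \<comment> \<open>Since e enters \<Phi> with the unfavourable sign, the quadrant becomes invariant
    only after e is small enough.\<close>
  have "((\<lambda>t. \<Phi> (e t) (a powr (2 - p)) ?X) \<longlongrightarrow> \<Phi> 0 (a powr (2 - p)) ?X) at_top"
    unfolding \<Phi>_def using p_gt_1 by (intro tendsto_intros e_tendsto) auto
  hence "\<forall>\<^sub>F t in at_top. \<Phi> (e t) (a powr (2 - p)) ?X > 0" 
    using \<Phi>_inverse_\<delta>_pos[OF assms] by (rule order_tendstoD)
  moreover have "((\<lambda>t. (\<alpha> + e t) * ?X) \<longlongrightarrow> (\<alpha> + 0) * ?X) at_top"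
    by (intro tendsto_intros e_tendsto)
  hence "\<forall>\<^sub>F t in at_top. (\<alpha> + e t) * ?X < 1" 
    by (rule order_tendstoD) (use \<alpha>_less_\<delta> \<delta>_pos in \<open>simp add: field_simps\<close>)
  ultimately have "\<forall>\<^sub>F t in at_top. \<Phi> (e t) (a powr (2 - p)) ?X > 0 \<and> (\<alpha> + e t) * ?X < 1"
    by eventually_elim blast
  then obtain T' where T': "T' \<ge> T"
    "\<And>t. t \<ge> T' \<Longrightarrow> \<Phi> (e t) (a powr (2 - p)) ?X > 0 \<and> (\<alpha> + e t) * ?X < 1"
    by (rule eventually_at_top_ge[where T = T]) blast
  have x_less: "x t < ?X" if "t \<ge> T'" "a \<le> y t" for t
  proof (rule ccontr)
    assume "\<not> x t < ?X"
    have y_ge: "a \<le> y s" if "t \<le> s" "\<And>r. t \<le> r \<Longrightarrow> r \<le> s \<Longrightarrow> ?X \<le> x r" for s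
    proof -
      have "y t \<le> y s"
      proof (rule DERIV_nonneg_imp_nondecreasing[OF \<open>t \<le> s\<close>])
        fix r assume r: "t \<le> r" "r \<le> s"
        hence "T \<le> r" using \<open>t \<ge> T'\<close> T' by simp
        have "0 \<le> (\<delta> - 1 / x r) * y r"
          using that(2)[OF r] x_pos[OF \<open>T \<le> r\<close>] y_pos[OF \<open>T \<le> r\<close>] \<delta>_pos
          by (intro mult_nonneg_nonneg) (auto simp: field_simps)
        thus "\<exists>D. (y has_real_derivative D) (at r) \<and> D \<ge> 0" using y_deriv[OF \<open>T \<le> r\<close>] by blast
      qed
      thus ?thesis using \<open>a \<le> y t\<close> by simp
    qed
    have x_ge: "?X \<le> x s" if "t \<le> s" for s
    proof (rule barrier_ge[OF x_deriv _ _ that])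
      fix r assume r: "t \<le> r" "x r = ?X" "\<And>u. t \<le> u \<Longrightarrow> u \<le> r \<Longrightarrow> ?X \<le> x u"
      hence "T \<le> r" "T' \<le> r" using \<open>t \<ge> T'\<close> T' by auto
      have "a \<le> y r" using y_ge[OF r(1,3)] .
      have "0 < \<Phi> (e r) (a powr (2 - p)) (x r)" unfolding r(2) using T'(2)[OF \<open>T' \<le> r\<close>] by simp
      also have "\<dots> \<le> \<Phi> (e r) (y r powr (2 - p)) (x r)"
        using x_pos[OF \<open>T \<le> r\<close>] \<open>a \<le> y r\<close> \<open>a > 0\<close> p_less_2 r(2) T'(2)[OF \<open>T' \<le> r\<close>]
        by (intro \<Phi>_mono powr_mono2) auto
      finally show "0 < \<Phi> (e r) (y r powr (2 - p)) (x r)" .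
    qed (use \<open>t \<ge> T'\<close> T' \<open>\<not> x t < ?X\<close> in auto)
    show False
      by (rule y_not_eventually_ge[OF assms, of t]) (use y_ge x_ge that T' in auto)
  qed
  obtain S where S: "S \<ge> T'" "y S \<le> a"
    using y_not_eventually_ge[OF assms T'(1)] by force
  have "y t \<le> a" if "S \<le> t" for t
  proof (rule barrier_le[OF y_deriv _ _ that])
    fix r assume r: "S \<le> r" "y r = a"
    hence "T \<le> r" using S T' by simp
    have "\<delta> < 1 / x r" using x_less[of r] r S x_pos[OF \<open>T \<le> r\<close>] \<delta>_pos by (simp add: field_simps)
    thus "(\<delta> - 1 / x r) * y r < 0" using y_pos[OF \<open>T \<le> r\<close>] by (simp add: mult_neg_pos)
  qed (use S T' in auto)
  thus ?thesis by (rule eventually_at_top_linorderI)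
qed

lemma y_tendsto: "(y \<longlongrightarrow> l) at_top"
proof (rule order_tendstoI)
  fix a assume "a < l"
  then obtain b where b: "max a 0 < b" "b < l" using dense[of "max a 0" l] l_pos by auto
  show "\<forall>\<^sub>F t in at_top. a < y t"
    using eventually_y_ge[of b] b by (auto elim: eventually_mono)
next
  fix a assume "l < a"
  then obtain b where b: "l < b" "b < a" using dense by blast
  show "\<forall>\<^sub>F t in at_top. y t < a"
    using eventually_y_le[of b] b by (auto elim: eventually_mono)
qed

end

section \<open>The range where \<open>\<delta> \<le> N\<close>\<close>

locale log_orbit_subcritical = log_orbit +
  assumes \<delta>_le_n: "\<delta> \<le> n"
begin

lemma n_pos: "n > 0" and \<alpha>_less_n: "\<alpha> < n" and n_le_\<eta>: "n \<le> \<eta>" and \<eta>_pos: "\<eta> > 0"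
proof -
  show "n > 0" "\<alpha> < n" using \<delta>_pos \<delta>_le_n \<alpha>_less_\<delta> by auto
  have "(p - 1) * (\<eta> - n) = (2 - p) * (n - \<delta>)"
    using p_gt_1 \<delta>_eq by (simp add: \<eta>_def field_simps)
  hence "0 \<le> (p - 1) * (\<eta> - n)" using \<delta>_le_n p_less_2 by simp
  thus "n \<le> \<eta>" using p_gt_1 by (simp add: zero_le_mult_iff)
  thus "\<eta> > 0" using \<open>n > 0\<close> by simp
qed

lemma e_small: obtains S where "S \<ge> T" "S \<ge> 0" "\<And>t. t \<ge> S \<Longrightarrow> e t \<le> (n - \<alpha>) / 2"
    "\<And>t. t \<ge> S \<Longrightarrow> e t \<le> exp (- (\<alpha> * (q - 1)) * t)"
proof -
  obtain E where E: "E \<ge> T" "\<And>t. t \<ge> E \<Longrightarrow> e t \<le> exp (- (\<alpha> * (q - 1)) * t)" using e_le by blast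
  have "\<forall>\<^sub>F t in at_top. e t < (n - \<alpha>) / 2"
    using e_tendsto \<alpha>_less_n by (intro order_tendstoD) auto
  then obtain S where "S \<ge> max 0 E" "\<And>t. t \<ge> S \<Longrightarrow> e t < (n - \<alpha>) / 2"
    by (rule eventually_at_top_ge[where T = "max 0 E"]) blast
  thus ?thesis using that[of S] E by force
qed

text \<open>At v = 1 the derivative of v is - n + \<alpha> + e < 0, so v cannot rise again from
  below 1. There (v - 1)/x <= 0 pushes v further down to some \<theta> < 1, and
  \<open>no_slow_decay\<close> applies.\<close>

lemma v_ge_1: obtains S where "S \<ge> T" "S \<ge> 0" "\<And>t. t \<ge> S \<Longrightarrow> 1 \<le> v t"
    "\<And>t. t \<ge> S \<Longrightarrow> e t \<le> (n - \<alpha>) / 2"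
proof -
  obtain S where S: "S \<ge> T" "S \<ge> 0" "\<And>t. t \<ge> S \<Longrightarrow> e t \<le> (n - \<alpha>) / 2"
    "\<And>t. t \<ge> S \<Longrightarrow> e t \<le> exp (- (\<alpha> * (q - 1)) * t)" using e_small by blast
  define a where "a = n - \<alpha>"
  have "a > 0" using \<alpha>_less_n by (simp add: a_def)
  have v'_eq: "v t * (1 / x t - n) - (1 / x t - \<alpha> - e t) = (v t - 1) / x t - n * v t + \<alpha> + e t" for t
    by (simp add: algebra_simps diff_divide_distrib)
  have "1 \<le> v s" if "s \<ge> S" for s
  proof (rule ccontr)
    assume "\<not> 1 \<le> v s"
    have v_le: "v t \<le> 1" if "s \<le> t" for t
    proof (rule barrier_le[OF v_deriv _ _ that])
      fix r assume "s \<le> r" "v r = 1"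
      thus "v r * (1 / x r - n) - (1 / x r - \<alpha> - e r) < 0"
        unfolding v'_eq using S(3)[of r] \<open>s \<ge> S\<close> \<open>a > 0\<close> by (simp add: a_def)
    qed (use \<open>\<not> 1 \<le> v s\<close> \<open>s \<ge> S\<close> S in auto)
    \<comment> \<open>Since n = \<alpha> + a, this lies strictly between (\<alpha> + a/2)/n and 1.
      With e <= a/2 a downward slope of a/4 remains for v >= \<theta>.\<close>
    define \<theta> where "\<theta> = (\<alpha> + 3 * a / 4) / n"
    have "\<theta> < 1" using n_pos \<open>a > 0\<close> by (simp add: \<theta>_def a_def field_simps)
    have "\<exists>U\<ge>s. \<forall>t\<ge>U. v t \<le> \<theta>"
    proof (rule eventually_le_of_deriv[OF v_deriv])
      fix r assume r: "s \<le> r" "\<theta> \<le> v r"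
      hence "T \<le> r" using \<open>s \<ge> S\<close> S by simp
      have "(v r - 1) / x r \<le> 0" using v_le[OF r(1)] x_pos[OF \<open>T \<le> r\<close>] by (simp add: divide_le_0_iff)
      moreover have "\<alpha> + 3 * a / 4 \<le> n * v r" using r(2) n_pos by (simp add: \<theta>_def field_simps)
      moreover have "e r \<le> a / 2" using S(3)[of r] r \<open>s \<ge> S\<close> by (simp add: a_def)
      ultimately show "v r * (1 / x r - n) - (1 / x r - \<alpha> - e r) \<le> - (a / 4)"
        unfolding v'_eq by linarith
    qed (use \<open>s \<ge> S\<close> S \<open>a > 0\<close> in auto)
    then obtain U where U: "U \<ge> s" "\<And>t. t \<ge> U \<Longrightarrow> v t \<le> \<theta>" by blast
    show False
    proof (rule no_slow_decay[of U \<theta> "\<alpha> * (q - 1)" 1])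
      fix t assume t: "t \<ge> U"
      hence t': "t \<ge> S" "t \<ge> T" using U \<open>s \<ge> S\<close> S by auto
      have "(n - \<alpha>) * v t \<ge> 0" using v_pos[OF t'(2)] \<alpha>_less_n by simp
      thus "- 1 * exp (- (\<alpha> * (q - 1)) * t) \<le> (n - \<alpha>) * v t - e t" using S(4)[OF t'(1)] by simp
    qed (use U \<open>\<theta> < 1\<close> \<open>s \<ge> S\<close> S \<alpha>_pos q_gt_1 in auto)
  qed
  thus ?thesis using that[of S] S by blast
qed

text \<open>At x = 1/n one has \<eta> x >= 1 and (\<alpha> + e) x < 1, so x could not return below
  1/n. Then v' = (v - 1)(1/x - n) - (n - \<alpha>) + e would be bounded above by a negative
  constant, contradicting v >= 1.\<close>

lemma x_le_inverse_n: obtains S where "S \<ge> T" "S \<ge> 0" "\<And>t. t \<ge> S \<Longrightarrow> 1 \<le> v t" "\<And>t. t \<ge> S \<Longrightarrow> x t \<le> 1 / n"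
    "\<And>t. t \<ge> S \<Longrightarrow> e t \<le> (n - \<alpha>) / 2"
proof -
  obtain S where S: "S \<ge> T" "S \<ge> 0" "\<And>t. t \<ge> S \<Longrightarrow> 1 \<le> v t"
    "\<And>t. t \<ge> S \<Longrightarrow> e t \<le> (n - \<alpha>) / 2" using v_ge_1 by blast
  have "x s \<le> 1 / n" if "s \<ge> S" for s
  proof (rule ccontr)
    assume "\<not> x s \<le> 1 / n"
    have x_ge: "1 / n \<le> x t" if "s \<le> t" for t
    proof (rule barrier_ge[OF x_deriv_v _ _ that])
      fix r assume r: "s \<le> r" "x r = 1 / n"
      hence r': "T \<le> r" "S \<le> r" using \<open>s \<ge> S\<close> S by auto
      have "(\<alpha> + e r) * x r < 1" unfolding r(2) using S(4)[OF r'(2)] n_pos \<alpha>_less_n by (simp add: field_simps)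
      moreover have "\<eta> * x r \<ge> 1" unfolding r(2) using n_le_\<eta> n_pos by simp
      ultimately show "0 < - 1 + \<eta> * x r + (1 - (\<alpha> + e r) * x r) / ((p - 1) * v r)"
        using v_pos[OF r'(1)] p_gt_1 by (intro add_nonneg_pos divide_pos_pos mult_pos_pos) auto
    qed (use \<open>\<not> x s \<le> 1 / n\<close> \<open>s \<ge> S\<close> S in auto)
    have "\<exists>U\<ge>s. \<forall>t\<ge>U. v t \<le> 0"
    proof (rule eventually_le_of_deriv[OF v_deriv])
      fix r assume r: "s \<le> r"
      hence r': "T \<le> r" "S \<le> r" using \<open>s \<ge> S\<close> S by auto
      have "1 / x r \<le> n" using x_ge[OF r] x_pos[OF r'(1)] n_pos by (simp add: field_simps)
      hence "(v r - 1) * (1 / x r - n) \<le> 0" using S(3)[OF r'(2)] by (intro mult_nonneg_nonpos) auto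
      moreover have "v r * (1 / x r - n) - (1 / x r - \<alpha> - e r) = (v r - 1) * (1 / x r - n) - (n - \<alpha>) + e r"
        by (simp add: algebra_simps)
      moreover have "a - h + b \<le> - (h / 2)" if "a \<le> 0" "b \<le> h / 2" for a b h :: real
        using that by simp
      ultimately show "v r * (1 / x r - n) - (1 / x r - \<alpha> - e r) \<le> - ((n - \<alpha>) / 2)"
        using S(4)[OF r'(2)] by metis
    qed (use \<open>s \<ge> S\<close> S \<alpha>_less_n in auto)
    then obtain U where "U \<ge> s" "v U \<le> 0" by blast
    thus False using S(3)[of U] \<open>s \<ge> S\<close> by simp
  qed
  thus ?thesis using that[of S] S by blast
qed

section \<open>The quantity r^N w and the flux Q\<close>

definition "P t = exp (n * t) * g t"
text \<open>In the original variables this is r^(N-1) |w'|^(p-1) - r^N w, the flux that appears when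
  (E) is multiplied by r^(N-1) and r^N w' is completed to the derivative of r^N w.\<close>

definition "Q t = P t * (v t - 1)"

lemma P_pos: "T \<le> t \<Longrightarrow> P t > 0" using g_pos by (simp add: P_def)

lemma P_deriv: "T \<le> t \<Longrightarrow> (P has_real_derivative (n - 1 / x t) * P t) (at t)"
  unfolding P_def[abs_def]
  by (rule derivative_eq_intros refl g_deriv | assumption)+ (simp add: algebra_simps)

text \<open>All terms in 1/x cancel, as they did for J in \<open>no_slow_decay\<close>.\<close>

lemma Q_deriv: 
  assumes "T \<le> t" shows "(Q has_real_derivative - (n - \<alpha> - e t) * P t) (at t)"
  unfolding Q_def[abs_def]
  by (rule derivative_eq_intros refl P_deriv[OF assms] v_deriv[OF assms])+
    (use x_pos[OF assms] in \<open>simp add: field_simps\<close>)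

text \<open>Both sides equal r^(N-1) |w'|^(p-1), because g/x = r |w'| and \<eta> (p - 1) = n - p.
  The identity turns knowledge of P v into knowledge of r^\<eta> w.\<close>

lemma P_mult_v:
  assumes "T \<le> t" shows "P t * v t = (exp (\<eta> * t) * g t / x t) powr (p - 1)"
proof -
  note pos = g_pos[OF assms] x_pos[OF assms]
  have 1: "exp (\<eta> * t) powr (p - 1) = exp (n * t) * exp (- p * t)"
    using p_gt_1 by (simp add: exp_powr_real \<eta>_def left_diff_distrib flip: exp_add) (simp add: field_simps)
  have 2: "g t powr (p - 1) = g t * g t powr (p - 2)"
    using powr_add[of "g t" 1 "p - 2"] pos by simp
  have 3: "x t powr (1 - p) = 1 / x t powr (p - 1)"
    using powr_minus_divide[of "x t" "p - 1"] by simp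
  have "(exp (\<eta> * t) * g t / x t) powr (p - 1) = exp (\<eta> * t) powr (p - 1) * g t powr (p - 1) / x t powr (p - 1)"
    using pos by (simp add: powr_mult powr_divide)
  thus ?thesis unfolding 1 2 P_def v_def 3 by simp
qed

text \<open>Q is positive because it is nonnegative and strictly decreasing. P is nonincreasing by x
  <= 1/n; if it stayed above a positive constant, the derivative of Q would be bounded away from 0
  and Q would become nonpositive.\<close>

lemma fast_decay:
  obtains S where "S \<ge> T" "S \<ge> 0" "\<And>t. t \<ge> S \<Longrightarrow> 1 \<le> v t" "\<And>t. t \<ge> S \<Longrightarrow> x t \<le> 1 / n"
    "\<And>t. t \<ge> S \<Longrightarrow> e t \<le> (n - \<alpha>) / 2" "\<And>t. t \<ge> S \<Longrightarrow> Q t > 0"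
    "\<And>s t. S \<le> s \<Longrightarrow> s \<le> t \<Longrightarrow> Q t \<le> Q s" "(P \<longlongrightarrow> 0) at_top"
proof -
  obtain S where S: "S \<ge> T" "S \<ge> 0" "\<And>t. t \<ge> S \<Longrightarrow> 1 \<le> v t" "\<And>t. t \<ge> S \<Longrightarrow> x t \<le> 1 / n"
    "\<And>t. t \<ge> S \<Longrightarrow> e t \<le> (n - \<alpha>) / 2" using x_le_inverse_n by blast
  have Q'_neg: "- (n - \<alpha> - e t) * P t < 0" if "t \<ge> S" for t
    using S(5)[OF that] P_pos[of t] that S(1) \<alpha>_less_n by (intro mult_neg_pos) auto
  have Q_nonneg: "Q t \<ge> 0" if "t \<ge> S" for t 
    using S(3)[OF that] P_pos[of t] that S(1) by (simp add: Q_def)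
  have Q_less: "Q t < Q s" if "S \<le> s" "s < t" for s t
  proof (rule DERIV_neg_imp_decreasing[OF that(2)])
    fix r assume "s \<le> r"
    thus "\<exists>y. DERIV Q r :> y \<and> y < 0" using Q_deriv[of r] Q'_neg[of r] S(1) that by fastforce
  qed
  have Q_pos: "Q t > 0" if "t \<ge> S" for t
    using Q_less[OF that, of "t + 1"] Q_nonneg[of "t + 1"] that by simp
  have P_le: "P t \<le> P s" if "S \<le> s" "s \<le> t" for s t
  proof (rule DERIV_nonpos_imp_nonincreasing[OF that(2)])
    fix r assume "s \<le> r"
    hence r: "S \<le> r" "T \<le> r" using that S by auto
    have "n - 1 / x r \<le> 0" using S(4)[OF r(1)] x_pos[OF r(2)] n_pos by (simp add: field_simps)
    hence "(n - 1 / x r) * P r \<le> 0" using P_pos[OF r(2)] by (intro mult_nonpos_nonneg) auto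
    thus "\<exists>y. DERIV P r :> y \<and> y \<le> 0" using P_deriv[OF r(2)] by blast
  qed
  have "(P \<longlongrightarrow> 0) at_top"
  proof (rule order_tendstoI)
    fix c :: real assume "c > 0"
    have "\<exists>s\<ge>S. P s < c"
    proof (rule ccontr)
      assume "\<not> ?thesis"
      hence P_ge: "P t \<ge> c" if "t \<ge> S" for t using that by force
      have "\<exists>U\<ge>S. \<forall>t\<ge>U. Q t \<le> 0"
      proof (rule eventually_le_of_deriv[OF Q_deriv])
        fix t assume t: "S \<le> t"
        have "(n - \<alpha>) / 2 * c \<le> (n - \<alpha> - e t) * P t"
          using P_ge[OF t] S(5)[OF t] \<open>c > 0\<close> \<alpha>_less_n by (intro mult_mono) auto
        thus "- (n - \<alpha> - e t) * P t \<le> - ((n - \<alpha>) / 2 * c)" 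
          by (simp only: mult_minus_left neg_le_iff_le)
      qed (use S \<open>c > 0\<close> \<alpha>_less_n in auto)
      thus False using Q_pos by force
    qed
    then obtain s where s: "s \<ge> S" "P s < c" by blast
    show "\<forall>\<^sub>F t in at_top. P t < c"
      by (rule eventually_at_top_linorderI[of s]) (use P_le[OF s(1)] s in force)
  next
    fix c :: real assume "c < 0"
    show "\<forall>\<^sub>F t in at_top. c < P t"
      by (rule eventually_at_top_linorderI[of T]) (use P_pos \<open>c < 0\<close> in force)
  qed
  moreover have "Q t \<le> Q s" if "S \<le> s" "s \<le> t" for s t
    using Q_less[of s t] that by (cases "s = t") auto
  ultimately show ?thesis using that[of S] S Q_pos by blast
qed

text \<open>The base of the power with exponent p - 2 is y written through P; the bound on x
  controls the factor x^(1-p).\<close>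

lemma v_lower_bound:
  assumes "T \<le> t" "x t \<le> 1 / n" 
  shows "n powr (p - 1) * (exp ((\<delta> - n) * t) * P t) powr (p - 2) \<le> v t"
proof -
  have "exp (\<delta> * t) powr (p - 2) = exp (- p * t)"
    using \<delta>_eq by (simp add: exp_powr_real algebra_simps)
  moreover have "exp ((\<delta> - n) * t) * P t = exp (\<delta> * t) * g t"
    by (simp add: P_def left_diff_distrib exp_diff)
  ultimately have "(exp ((\<delta> - n) * t) * P t) powr (p - 2) = g t powr (p - 2) * exp (- p * t)"
    using g_pos[OF assms(1)] by (simp add: powr_mult)
  moreover have "n powr (p - 1) \<le> x t powr (1 - p)"
  proof -
    have "(1 / n) powr (1 - p) \<le> x t powr (1 - p)"
      using p_gt_1 assms x_pos[OF assms(1)] by (intro powr_mono2') auto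
    moreover have "(1 / n) powr (1 - p) = n powr (p - 1)"
      using n_pos powr_minus_divide[of n "p - 1"] by (simp add: powr_divide)
    ultimately show ?thesis by simp
  qed
  ultimately show ?thesis using g_pos[OF assms(1)]
    by (simp add: v_def mult.assoc mult_right_mono)
qed

section \<open>Limits of v and x\<close>

lemma v_at_top: "filterlim v at_top at_top"
proof -
  obtain S where S: "S \<ge> T" "S \<ge> 0" "\<And>t. t \<ge> S \<Longrightarrow> x t \<le> 1 / n" "(P \<longlongrightarrow> 0) at_top"
    using fast_decay by metis
  have "filterlim P (at_right 0) at_top"
    unfolding filterlim_at using S(4) by (auto intro!: eventually_at_top_linorderI[of T] dest: P_pos)
  moreover have "filterlim (\<lambda>z. n powr (p - 1) * z powr (p - 2)) at_top (at_right 0)"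
    using n_pos p_less_2 by real_asymp
  ultimately have "filterlim (\<lambda>t. n powr (p - 1) * P t powr (p - 2)) at_top at_top"
    by (rule filterlim_compose[rotated])
  moreover have "\<forall>\<^sub>F t in at_top. n powr (p - 1) * P t powr (p - 2) \<le> v t"
  proof (rule eventually_at_top_linorderI[of S])
    fix t assume t: "S \<le> t"
    hence t': "T \<le> t" "0 \<le> t" using S by auto
    \<comment> \<open>The exponent p - 2 is negative, so dropping this factor only weakens the lower
      bound, and P tending to 0 drives it to infinity.\<close>
    have "exp ((\<delta> - n) * t) \<le> 1" using \<delta>_le_n t'(2) by (simp add: mult_nonpos_nonneg)
    hence "exp ((\<delta> - n) * t) * P t \<le> 1 * P t" using P_pos[OF t'(1)] by (intro mult_right_mono) auto
    hence "P t powr (p - 2) \<le> (exp ((\<delta> - n) * t) * P t) powr (p - 2)"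
      using P_pos[OF t'(1)] p_less_2 by (intro powr_mono2') auto
    hence "n powr (p - 1) * P t powr (p - 2) \<le> n powr (p - 1) * (exp ((\<delta> - n) * t) * P t) powr (p - 2)"
      by (intro mult_left_mono) auto
    thus "n powr (p - 1) * P t powr (p - 2) \<le> v t"
      using v_lower_bound[OF t'(1) S(3)[OF t]] by simp
  qed
  ultimately show ?thesis by (rule filterlim_at_top_mono)
qed

text \<open>As v tends to infinity, the x equation becomes x' = \<eta> x - 1 up to a vanishing
  error. Its equilibrium is repelling, and x is bounded by 1/n.\<close>

lemma x_tendsto: "(x \<longlongrightarrow> 1 / \<eta>) at_top"
proof -
  obtain S where S: "S \<ge> T" "S \<ge> 0" "\<And>t. t \<ge> S \<Longrightarrow> x t \<le> 1 / n" 
    "\<And>t. t \<ge> S \<Longrightarrow> e t \<le> (n - \<alpha>) / 2" using fast_decay by metis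
  let ?r = "\<lambda>t. (1 - (\<alpha> + e t) * x t) / ((p - 1) * v t)"
  show ?thesis
  proof (rule unstable_linear_tendsto[of S, OF x_deriv_v])
    show "\<bar>x t\<bar> \<le> 1 / n" if "S \<le> t" for t using S(3)[OF that] x_pos[of t] that S(1) by simp
    have "(?r \<longlongrightarrow> 0) at_top"
    proof (rule tendsto_sandwich)
      have bd: "0 \<le> (\<alpha> + e t) * x t \<and> (\<alpha> + e t) * x t \<le> 1 \<and> 0 < (p - 1) * v t" if "S \<le> t" for t
      proof -
        have t: "T \<le> t" using that S by simp
        have "(\<alpha> + e t) * x t \<le> n * (1 / n)"
          using S(3,4)[OF that] n_pos \<alpha>_less_n x_pos[OF t] by (intro mult_mono) auto
        thus ?thesis using n_pos \<alpha>_pos e_pos[OF t] x_pos[OF t] v_pos[OF t] p_gt_1 by simp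
      qed
      show "\<forall>\<^sub>F t in at_top. 0 \<le> ?r t"
        by (rule eventually_at_top_linorderI[of S]) (use bd in \<open>auto intro!: divide_nonneg_pos\<close>)
      show "\<forall>\<^sub>F t in at_top. ?r t \<le> inverse ((p - 1) * v t)"
        by (rule eventually_at_top_linorderI[of S])
          (unfold inverse_eq_divide, rule divide_right_mono, use bd in force, use bd less_imp_le in blast)
      have "filterlim (\<lambda>t. (p - 1) * v t) at_top at_top"
        using p_gt_1 by (intro filterlim_tendsto_pos_mult_at_top[OF tendsto_const _ v_at_top]) auto
      thus "((\<lambda>t. inverse ((p - 1) * v t)) \<longlongrightarrow> 0) at_top"
        by (rule tendsto_inverse_0_at_top)
    qed simp
    thus "((\<lambda>t. - 1 + \<eta> * x t + ?r t - \<eta> * x t + 1) \<longlongrightarrow> 0) at_top" by simp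
  qed (use S \<eta>_pos in auto)
qed

text \<open>For \<delta> < n, v grows exponentially, so Q'/Q = - (n - \<alpha> - e)/(v - 1) is
  integrable and Q has a positive limit L. Then P v = Q + P tends to L, and \<open>P_mult_v\<close>
  together with the limit of x yields r^\<eta> w.\<close>

lemma subcritical_tendsto:
  assumes "\<delta> < n"
  shows "\<exists>c>0. ((\<lambda>t. exp (\<eta> * t) * g t) \<longlongrightarrow> c) at_top"
proof -
  obtain S where S: "S \<ge> T" "S \<ge> 0" "\<And>t. t \<ge> S \<Longrightarrow> 1 \<le> v t" "\<And>t. t \<ge> S \<Longrightarrow> x t \<le> 1 / n"
    "\<And>t. t \<ge> S \<Longrightarrow> e t \<le> (n - \<alpha>) / 2" "\<And>t. t \<ge> S \<Longrightarrow> Q t > 0"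
    "\<And>s t. S \<le> s \<Longrightarrow> s \<le> t \<Longrightarrow> Q t \<le> Q s" "(P \<longlongrightarrow> 0) at_top" using fast_decay by blast
  define \<kappa> where "\<kappa> = (2 - p) * (n - \<delta>)"
  have "\<kappa> > 0" using assms p_less_2 by (simp add: \<kappa>_def)
  have "\<forall>\<^sub>F t in at_top. P t < 1" using S(8) by (rule order_tendstoD) simp
  moreover have "\<forall>\<^sub>F t in at_top. 2 \<le> v t" using v_at_top by (simp add: filterlim_at_top)
  ultimately have "\<forall>\<^sub>F t in at_top. P t < 1 \<and> 2 \<le> v t" by eventually_elim blast
  then obtain U where U: "U \<ge> S" "\<And>t. t \<ge> U \<Longrightarrow> P t < 1 \<and> 2 \<le> v t"
    by (rule eventually_at_top_ge[where T = S]) blast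
  have v_ge: "n powr (p - 1) * exp (\<kappa> * t) \<le> v t" if "t \<ge> U" for t
  proof -
    have t: "T \<le> t" "S \<le> t" using that U S by auto
    have "exp ((\<delta> - n) * t) * P t \<le> exp ((\<delta> - n) * t) * 1"
      using U(2)[OF that] by (intro mult_left_mono) auto
    hence "exp ((\<delta> - n) * t) powr (p - 2) \<le> (exp ((\<delta> - n) * t) * P t) powr (p - 2)"
      using P_pos[OF t(1)] p_less_2 by (intro powr_mono2') auto
    moreover have "exp ((\<delta> - n) * t) powr (p - 2) = exp (\<kappa> * t)"
      by (simp add: exp_powr_real \<kappa>_def algebra_simps)
    ultimately have "n powr (p - 1) * exp (\<kappa> * t) \<le> n powr (p - 1) * (exp ((\<delta> - n) * t) * P t) powr (p - 2)"
      by (intro mult_left_mono) auto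
    thus ?thesis using v_lower_bound[OF t(1) S(4)[OF t(2)]] by simp
  qed
  \<comment> \<open>Gives (n - \<alpha>)/(v - 1) <= C exp (- \<kappa> t); the factor 2 comes from v
    - 1 >= v/2 for v >= 2.\<close>
  define C where "C = 2 * (n - \<alpha>) / n powr (p - 1)"
  have "\<exists>c>0. \<forall>t\<ge>U. c \<le> Q t"
  proof (rule lower_bound_of_integrable_decay[of U, OF Q_deriv])
    fix t assume t: "U \<le> t"
    hence t': "T \<le> t" using U S by simp
    have "n powr (p - 1) * exp (\<kappa> * t) / 2 \<le> v t - 1"
      using v_ge[OF t] U(2)[OF t] by linarith
    hence "C * exp (- \<kappa> * t) * (n powr (p - 1) * exp (\<kappa> * t) / 2) \<le> C * exp (- \<kappa> * t) * (v t - 1)"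
      using \<alpha>_less_n by (intro mult_left_mono) (auto simp: C_def)
    moreover have "C * exp (- \<kappa> * t) * (n powr (p - 1) * exp (\<kappa> * t) / 2) = n - \<alpha>"
      using n_pos by (simp add: C_def exp_minus)
    ultimately have "n - \<alpha> \<le> C * exp (- \<kappa> * t) * (v t - 1)" by simp
    hence "n - \<alpha> - e t \<le> C * exp (- \<kappa> * t) * (v t - 1)" using e_pos[OF t'] by simp
    hence "(n - \<alpha> - e t) * P t \<le> C * exp (- \<kappa> * t) * (v t - 1) * P t"
      using P_pos[OF t'] by (intro mult_right_mono) auto
    thus "- C * exp (- \<kappa> * t) * Q t \<le> - (n - \<alpha> - e t) * P t"
      unfolding Q_def mult_minus_left neg_le_iff_le by (simp only: mult_ac)
  qed (use U S \<open>\<kappa> > 0\<close> \<alpha>_less_n in \<open>auto simp: C_def\<close>)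
  then obtain c where c: "c > 0" "\<And>t. U \<le> t \<Longrightarrow> c \<le> Q t" by blast
  then obtain L where L: "L \<ge> c" "(Q \<longlongrightarrow> L) at_top"
    using nonincreasing_tendsto[of U Q c] S(7) U(1) by (meson order_trans)
  have "((\<lambda>t. P t * v t) \<longlongrightarrow> 0 + L) at_top"
    using tendsto_add[OF S(8) L(2)] by (simp add: Q_def algebra_simps)
  hence "((\<lambda>t. (P t * v t) powr (1 / (p - 1))) \<longlongrightarrow> L powr (1 / (p - 1))) at_top"
    using L c by (intro tendsto_intros) auto
  moreover have "\<forall>\<^sub>F t in at_top. (P t * v t) powr (1 / (p - 1)) = exp (\<eta> * t) * g t / x t"
    by (rule eventually_at_top_linorderI[of T])
      (use P_mult_v p_gt_1 g_pos x_pos in \<open>auto simp: powr_powr less_imp_le\<close>)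
  ultimately have "((\<lambda>t. exp (\<eta> * t) * g t / x t) \<longlongrightarrow> L powr (1 / (p - 1))) at_top"
    by (rule Lim_transform_eventually)
  hence "((\<lambda>t. exp (\<eta> * t) * g t / x t * x t) \<longlongrightarrow> L powr (1 / (p - 1)) * (1 / \<eta>)) at_top"
    using x_tendsto by (rule tendsto_mult)
  moreover have "\<forall>\<^sub>F t in at_top. exp (\<eta> * t) * g t / x t * x t = exp (\<eta> * t) * g t"
    by (rule eventually_at_top_linorderI[of T]) (use x_pos in force)
  ultimately have "((\<lambda>t. exp (\<eta> * t) * g t) \<longlongrightarrow> L powr (1 / (p - 1)) * (1 / \<eta>)) at_top"
    by (rule Lim_transform_eventually)
  moreover have "L powr (1 / (p - 1)) * (1 / \<eta>) > 0" using L c \<eta>_pos by simp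
  ultimately show ?thesis by blast
qed

text \<open>Now \<eta> = n, and P is asymptotic to Q^(1/(p-1)) / n. The equation Q' = - (n -
  \<alpha> - e) P is therefore asymptotically separable: Q^(- \<beta>) grows like m t, and solving
  back for P gives the logarithmic correction, since t = ln r.\<close>

lemma critical_tendsto:
  assumes "\<delta> = n"
  shows "((\<lambda>t. exp (n * t) * t powr (1 / (2 - p)) * g t) \<longlongrightarrow>
    1 / n * ((p - 1) * n / ((2 - p) * (n - \<alpha>))) powr (1 / (2 - p))) at_top"
proof -
  obtain S where S: "S \<ge> T" "S \<ge> 0" "\<And>t. t \<ge> S \<Longrightarrow> 1 \<le> v t" "\<And>t. t \<ge> S \<Longrightarrow> Q t > 0" 
    using fast_decay by metis
  have "\<eta> = n" unfolding \<eta>_eq using assms by simp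
  define \<beta> where "\<beta> = (2 - p) / (p - 1)"
  have "\<beta> > 0" using p_gt_1 p_less_2 by (simp add: \<beta>_def)
  define m where "m = \<beta> * (n - \<alpha>) / n"
  have "m > 0" using \<open>\<beta> > 0\<close> \<alpha>_less_n n_pos by (simp add: m_def)
  have ratio_eq: "P t / Q t powr (1 / (p - 1)) = x t * (1 - 1 / v t) powr (- (1 / (p - 1)))" if "S \<le> t" for t
  proof -
    have t: "T \<le> t" using that S by simp
    note pos = P_pos[OF t] x_pos[OF t] v_pos[OF t]
    have "Q t = (P t * v t) * (1 - 1 / v t)" using pos by (simp add: Q_def field_simps)
    also have "P t * v t = (P t / x t) powr (p - 1)"
      using P_mult_v[OF t] by (simp add: \<open>\<eta> = n\<close> P_def)
    finally have Q_eq: "Q t = (P t / x t) powr (p - 1) * (1 - 1 / v t)" .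
    have "1 - 1 / v t > 0" 
      using S(4)[OF that] S(3)[OF that] pos unfolding Q_def by (simp add: zero_less_mult_iff)
    hence "Q t powr (1 / (p - 1)) = P t / x t * (1 - 1 / v t) powr (1 / (p - 1))"
      unfolding Q_eq using pos p_gt_1 by (simp add: powr_mult powr_powr)
    moreover have "P t / (P t / x t * z) = x t * inverse z" for z
      using pos by (simp add: field_simps)
    ultimately show ?thesis by (simp add: powr_minus)
  qed
  have "((\<lambda>t. 1 / v t) \<longlongrightarrow> 0) at_top"
    using tendsto_inverse_0_at_top[OF v_at_top] by (simp add: inverse_eq_divide)
  hence "((\<lambda>t. x t * (1 - 1 / v t) powr (- (1 / (p - 1)))) \<longlongrightarrow> 1 / n * (1 - 0) powr (- (1 / (p - 1)))) at_top"
    using x_tendsto unfolding \<open>\<eta> = n\<close> by (intro tendsto_intros) auto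
  moreover have "\<forall>\<^sub>F t in at_top. x t * (1 - 1 / v t) powr (- (1 / (p - 1))) = P t / Q t powr (1 / (p - 1))"
    by (rule eventually_at_top_linorderI[of S]) (use ratio_eq in simp)
  ultimately have "((\<lambda>t. P t / Q t powr (1 / (p - 1))) \<longlongrightarrow> 1 / n * (1 - 0) powr (- (1 / (p - 1)))) at_top"
    by (rule Lim_transform_eventually)
  hence ratio: "((\<lambda>t. P t / Q t powr (1 / (p - 1))) \<longlongrightarrow> 1 / n) at_top" by simp
  have "((\<lambda>t. Q t powr (- \<beta>) / t) \<longlongrightarrow> m) at_top"
  proof (rule lhospital_at_top_at_top)
    show "filterlim (\<lambda>t::real. t) at_top at_top" by (rule filterlim_ident)
    show "\<forall>\<^sub>F t in at_top. ((\<lambda>t. Q t powr (- \<beta>)) has_real_derivative 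
        \<beta> * (n - \<alpha> - e t) * (P t / Q t powr (1 / (p - 1)))) (at t)"
    proof (rule eventually_at_top_linorderI[of S])
      fix t assume t: "S \<le> t"
      hence t': "T \<le> t" using S by simp
      \<comment> \<open>\<beta> is chosen with \<beta> + 1 = 1/(p - 1), so that the derivative of
        Q^(- \<beta>) contains exactly the ratio whose limit is known.\<close>
      have "Q t powr (- \<beta> - 1) = Q t powr (- (1 / (p - 1)))"
        using p_gt_1 by (simp add: \<beta>_def field_simps)
      also have "\<dots> = 1 / Q t powr (1 / (p - 1))" by (simp add: powr_minus_divide)
      finally have *: "Q t powr (- \<beta> - 1) = 1 / Q t powr (1 / (p - 1))" .
      show "((\<lambda>t. Q t powr (- \<beta>)) has_real_derivative 
        \<beta> * (n - \<alpha> - e t) * (P t / Q t powr (1 / (p - 1)))) (at t)"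
        by (rule DERIV_cong[OF DERIV_fun_powr[OF Q_deriv[OF t'] S(4)[OF t]]]) (simp add: * algebra_simps diff_divide_distrib add_divide_distrib)
    qed
    have "((\<lambda>t. \<beta> * (n - \<alpha> - e t) * (P t / Q t powr (1 / (p - 1)))) \<longlongrightarrow> \<beta> * (n - \<alpha> - 0) * (1 / n)) at_top"
      by (intro tendsto_intros e_tendsto ratio)
    thus "((\<lambda>t. \<beta> * (n - \<alpha> - e t) * (P t / Q t powr (1 / (p - 1))) / 1) \<longlongrightarrow> m) at_top"
      by (simp add: m_def)
  qed (auto intro: DERIV_ident)
  hence "((\<lambda>t. (Q t powr (- \<beta>) / t) powr (- (1 / (2 - p)))) \<longlongrightarrow> m powr (- (1 / (2 - p)))) at_top"
    using \<open>m > 0\<close> by (intro tendsto_intros) auto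
  hence "((\<lambda>t. P t / Q t powr (1 / (p - 1)) * (Q t powr (- \<beta>) / t) powr (- (1 / (2 - p)))) 
      \<longlongrightarrow> 1 / n * m powr (- (1 / (2 - p)))) at_top"
    by (intro tendsto_mult ratio)
  moreover have "\<forall>\<^sub>F t in at_top. P t / Q t powr (1 / (p - 1)) * (Q t powr (- \<beta>) / t) powr (- (1 / (2 - p)))
     = exp (n * t) * t powr (1 / (2 - p)) * g t"
  proof (rule eventually_at_top_linorderI[of "S + 1"])
    fix t assume "S + 1 \<le> t"
    hence t: "S \<le> t" "t > 0" using S by auto
    \<comment> \<open>With these exponents the powers of Q cancel in the product, leaving P
      t^(1/(2-p)).\<close>
    have "\<beta> / (2 - p) = 1 / (p - 1)" using p_less_2 by (simp add: \<beta>_def)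
    hence "(Q t powr (- \<beta>) / t) powr (- (1 / (2 - p))) = Q t powr (1 / (p - 1)) * t powr (1 / (2 - p))"
    proof -
      have 1: "(Q t powr (- \<beta>) / t) powr (- (1 / (2 - p)))
          = (Q t powr (- \<beta>)) powr (- (1 / (2 - p))) / t powr (- (1 / (2 - p)))"
        by (rule powr_divide)
      have 2: "(Q t powr (- \<beta>)) powr (- (1 / (2 - p))) = Q t powr (1 / (p - 1))"
        unfolding powr_powr using \<open>\<beta> / (2 - p) = 1 / (p - 1)\<close> by simp
      show ?thesis unfolding 1 2 by (simp add: powr_minus_divide)
    qed
    thus "P t / Q t powr (1 / (p - 1)) * (Q t powr (- \<beta>) / t) powr (- (1 / (2 - p)))
     = exp (n * t) * t powr (1 / (2 - p)) * g t"
      using S(4)[OF t(1)] by (simp add: P_def mult_ac)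
  qed
  ultimately have "((\<lambda>t. exp (n * t) * t powr (1 / (2 - p)) * g t) \<longlongrightarrow> 1 / n * m powr (- (1 / (2 - p)))) at_top"
    by (rule Lim_transform_eventually)
  moreover have "m powr (- (1 / (2 - p))) = ((p - 1) * n / ((2 - p) * (n - \<alpha>))) powr (1 / (2 - p))"
  proof -
    have "m powr (- (1 / (2 - p))) = (1 / m) powr (1 / (2 - p))"
      using \<open>m > 0\<close> by (simp add: powr_minus powr_divide field_simps)
    thus ?thesis by (simp add: m_def \<beta>_def)
  qed
  ultimately show ?thesis by simp
qed

end

section \<open>Reduction of the equation\<close>

lemma spow_eq_0_iff: "spow a z = 0 \<longleftrightarrow> z = 0"
  and spow_less_0_iff: "spow a z < 0 \<longleftrightarrow> z < 0"
  by (cases "z = 0") (auto simp: spow_def mult_less_0_iff)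

lemma spow_minus: "spow a (- z) = - spow a z"
  by (simp add: spow_def)

lemma spow_nonneg: "0 \<le> z \<Longrightarrow> spow a z = z powr a"
  using powr_add[of z 1 "a - 1"] by (cases "z = 0") (auto simp: spow_def)

lemma tendsto_of_exp:
  fixes f :: "real \<Rightarrow> real"
  assumes "((\<lambda>t. f (exp t)) \<longlongrightarrow> c) at_top"
  shows "(f \<longlongrightarrow> c) at_top"
proof -
  have "((\<lambda>r. f (exp (ln r))) \<longlongrightarrow> c) at_top"
    using filterlim_compose[OF assms ln_at_top] by simp
  moreover have "\<forall>\<^sub>F r in at_top. f (exp (ln r)) = f r"
    by (rule eventually_at_top_linorderI[of 1]) simp
  ultimately show ?thesis by (rule Lim_transform_eventually)
qed

lemma is_solution_derivs:
  assumes "is_solution N p q \<alpha> R w" "R < r"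
  shows "(w has_real_derivative deriv w r) (at r)"
    and "((\<lambda>s. spow (p - 1) (deriv w s)) has_real_derivative
      - (real N - 1) / r * spow (p - 1) (deriv w r) - r * deriv w r - \<alpha> * w r - spow q (w r)) (at r)"
proof -
  have diff: "f field_differentiable at r" if "f C1_differentiable_on {R<..}" for f :: "real \<Rightarrow> real"
    using that assms(2) unfolding C1_differentiable_on_def
    by (auto simp: field_differentiable_def has_real_derivative_iff_has_vector_derivative)
  show "(w has_real_derivative deriv w r) (at r)"
    using diff assms(1) by (auto simp: is_solution_def DERIV_deriv_iff_field_differentiable)
  let ?F = "\<lambda>s. spow (p - 1) (deriv w s)"
  have "deriv ?F r + (real N - 1) / r * spow (p - 1) (deriv w r) + r * deriv w r + \<alpha> * w r + spow q (w r) = 0"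
    using assms by (auto simp: is_solution_def)
  hence "deriv ?F r = - (real N - 1) / r * spow (p - 1) (deriv w r) - r * deriv w r - \<alpha> * w r - spow q (w r)"
    unfolding minus_divide_left[symmetric] mult_minus_left by linarith
  moreover have "(?F has_real_derivative deriv ?F r) (at r)"
    using diff assms(1) by (auto simp: is_solution_def DERIV_deriv_iff_field_differentiable)
  ultimately show "(?F has_real_derivative
      - (real N - 1) / r * spow (p - 1) (deriv w r) - r * deriv w r - \<alpha> * w r - spow q (w r)) (at r)"
    by simp
qed

lemma eventually_sign_of_finite_zeros:
  fixes w :: "real \<Rightarrow> real"
  assumes "finite {r \<in> {R<..}. w r = 0}" "continuous_on {R<..} w"
  obtains S \<sigma> where "S > R" "\<sigma> \<in> {1, - 1 :: real}" "\<And>r. r \<ge> S \<Longrightarrow> \<sigma> * w r > 0"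
proof -
  \<comment> \<open>Inserting \<open>R\<close> makes the maximum exist even without zeros and places
    \<open>S\<close> beyond \<open>R\<close>.\<close>
  let ?Z = "insert R {r \<in> {R<..}. w r = 0}"
  define S where "S = Max ?Z + 1"
  have fin: "finite ?Z" using assms(1) by simp
  have "S > R" using Max_ge[OF fin, of R] by (simp add: S_def)
  have nz: "w r \<noteq> 0" if "r \<ge> S" for r
  proof
    assume "w r = 0"
    hence "r \<in> ?Z" using that \<open>S > R\<close> by simp
    thus False using Max_ge[OF fin, of r] that by (simp add: S_def)
  qed
  have cont: "continuous_on {S..r} w" for r
    by (rule continuous_on_subset[OF assms(2)]) (use \<open>S > R\<close> in auto)
  have same: "w S * w r > 0" if "r \<ge> S" for r
  proof (rule ccontr)
    assume "\<not> ?thesis"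
    hence "(w S \<le> 0 \<and> 0 \<le> w r) \<or> (w r \<le> 0 \<and> 0 \<le> w S)" by (auto simp: zero_less_mult_iff)
    hence "\<exists>z\<ge>S. z \<le> r \<and> w z = 0"
      using IVT'[of w S 0 r] IVT2'[of w r 0 S] cont that by blast
    thus False using nz by blast
  qed
  show ?thesis
    by (rule that[of S "sgn (w S)"]) (use same nz[of S] \<open>S > R\<close> in \<open>auto simp: sgn_if zero_less_mult_iff split: if_splits\<close>)
qed

text \<open>u' need not be differentiable at its zeros, so its signed power F is followed instead.
  Where F = 0 the equation gives F' = - (\<alpha> u + u^q) < 0, so F crosses 0 only downwards. It
  does become nonpositive, as an increasing positive u cannot tend to 0. A later zero would force F
  > 0 just before it.\<close>

lemma positive_solution_decreasing:
  fixes u u' :: "real \<Rightarrow> real"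
  assumes "0 < \<alpha>"
    and du: "\<And>r. r \<ge> S \<Longrightarrow> (u has_real_derivative u' r) (at r)"
    and dF: "\<And>r. r \<ge> S \<Longrightarrow> ((\<lambda>s. spow a (u' s)) has_real_derivative
      - (n - 1) / r * spow a (u' r) - r * u' r - \<alpha> * u r - u r powr q) (at r)"
    and pos: "\<And>r. r \<ge> S \<Longrightarrow> u r > 0" and lim: "(u \<longlongrightarrow> 0) at_top"
  obtains S' where "S' \<ge> S" "\<And>r. r > S' \<Longrightarrow> u' r < 0"
proof -
  let ?F = "\<lambda>s. spow a (u' s)"
  let ?F' = "\<lambda>r. - (n - 1) / r * spow a (u' r) - r * u' r - \<alpha> * u r - u r powr q"
  have F'_neg: "?F' r < 0" if "r \<ge> S" "?F r = 0" for r
  proof -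
    have "u' r = 0" using that by (simp add: spow_eq_0_iff)
    hence "?F' r = - (\<alpha> * u r + u r powr q)" using that(2) by simp
    moreover have "\<alpha> * u r > 0" using pos[OF that(1)] \<open>0 < \<alpha>\<close> by simp
    ultimately show ?thesis using powr_ge_zero[of "u r" q] by linarith
  qed
  have "\<exists>S'\<ge>S. ?F S' \<le> 0"
  proof (rule ccontr)
    assume "\<not> ?thesis"
    hence u'_pos: "u' r > 0" if "r \<ge> S" for r
      using that spow_less_0_iff[of a "u' r"] spow_eq_0_iff[of a "u' r"] by force
    have "u S \<le> u r" if "r \<ge> S" for r
      by (rule DERIV_nonneg_imp_nondecreasing[OF that]) (use du u'_pos less_imp_le in blast)
    moreover have "\<forall>\<^sub>F r in at_top. u r < u S" using lim pos[of S] by (intro order_tendstoD) auto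
    then obtain r where "r \<ge> S" "u r < u S" by (rule eventually_at_top_ge[where T = S]) blast
    ultimately show False by force
  qed
  then obtain S' where S': "S' \<ge> S" "?F S' \<le> 0" by blast
  have F_le: "?F r \<le> 0" if "r \<ge> S'" for r
    by (rule barrier_le[of S' ?F ?F', OF dF S'(2) F'_neg that]) (use S' in auto)
  have "u' r < 0" if "r > S'" for r
  proof (rule ccontr)
    assume "\<not> u' r < 0"
    hence 0: "?F r = 0" using F_le[of r] that spow_less_0_iff[of a "u' r"] by simp
    have "r \<ge> S" using that S' by simp
    obtain d where d: "d > 0" "\<And>h. 0 < h \<Longrightarrow> h < d \<Longrightarrow> ?F r < ?F (r - h)"
      using DERIV_neg_dec_left[OF dF[OF \<open>r \<ge> S\<close>] F'_neg[OF \<open>r \<ge> S\<close> 0]] by blast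
    define h where "h = min (d / 2) (r - S')"
    have "0 < h" "h < d" "r - h \<ge> S'" using d(1) that by (auto simp: h_def)
    thus False using d(2)[of h] F_le[of "r - h"] 0 by simp
  qed
  thus ?thesis using that S'(1) by blast
qed

text \<open>Once u' < 0, |u'| is the power 1/(p - 1) of a differentiable positive function. It is
  thus differentiable itself, and x can be differentiated as a quotient.\<close>

lemma log_orbit_of_positive_solution:
  fixes u u' :: "real \<Rightarrow> real"
  assumes p: "1 < p" "p < 2" and "1 < q" "0 < \<alpha>" "\<alpha> < p / (2 - p)" "S > 0"
    and du: "\<And>r. r \<ge> S \<Longrightarrow> (u has_real_derivative u' r) (at r)"
    and dF: "\<And>r. r \<ge> S \<Longrightarrow> ((\<lambda>s. spow (p - 1) (u' s)) has_real_derivative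
      - (n - 1) / r * spow (p - 1) (u' r) - r * u' r - \<alpha> * u r - u r powr q) (at r)"
    and pos: "\<And>r. r \<ge> S \<Longrightarrow> u r > 0" and decay: "((\<lambda>r. r powr \<alpha> * u r) \<longlongrightarrow> 0) at_top"
  shows "\<exists>T x. log_orbit n p q \<alpha> T (\<lambda>t. u (exp t)) x"
proof -
  have "((\<lambda>r. r powr \<alpha> * u r * r powr (- \<alpha>)) \<longlongrightarrow> 0 * 0) at_top"
    using \<open>0 < \<alpha>\<close> by (intro tendsto_mult decay tendsto_neg_powr) (auto simp: filterlim_ident)
  moreover have "\<forall>\<^sub>F r in at_top. r powr \<alpha> * u r * r powr (- \<alpha>) = u r"
    by (rule eventually_at_top_linorderI[of 1]) (simp add: powr_minus field_simps)
  ultimately have "(u \<longlongrightarrow> 0 * 0) at_top" by (rule Lim_transform_eventually)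
  hence lim: "(u \<longlongrightarrow> 0) at_top" by simp
  obtain S' where S': "S' \<ge> S" "\<And>r. r > S' \<Longrightarrow> u' r < 0"
    by (rule positive_solution_decreasing[of \<alpha> S u u' "p - 1" n q]) (use assms lim in auto)
  define B where "B r = - u' r" for r
  have B_pos: "B r > 0" if "r > S'" for r using S'(2)[OF that] by (simp add: B_def)
  have F_eq: "spow (p - 1) (u' r) = - (B r powr (p - 1))" if "r > S'" for r
    using spow_minus[of "p - 1" "B r"] spow_nonneg[of "B r" "p - 1"] B_pos[OF that] by (simp add: B_def)
  define B' where "B' r = 1 / (p - 1) * (B r / B r powr (p - 1)) * 
    (- (n - 1) / r * B r powr (p - 1) - r * B r + \<alpha> * u r + u r powr q)" for r
  have B_deriv: "(B has_real_derivative B' r) (at r)" if "r > S'" for r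
  proof (rule has_field_derivative_transform_within_open
      [where f = "\<lambda>s. (- spow (p - 1) (u' s)) powr (1 / (p - 1))" and S = "{S'<..}"])
    show "(- spow (p - 1) (u' s)) powr (1 / (p - 1)) = B s" if "s \<in> {S'<..}" for s
      using that B_pos[of s] F_eq[of s] p by (simp add: powr_powr)
  next
    have z: "- spow (p - 1) (u' r) = B r powr (p - 1)" using F_eq[OF that] by simp
    have "(B r powr (p - 1)) powr (1 / (p - 1) - 1) = B r / B r powr (p - 1)"
      using B_pos[OF that] p by (subst powr_diff) (simp add: powr_powr)
    moreover have "- (- (n - 1) / r * spow (p - 1) (u' r) - r * u' r - \<alpha> * u r - u r powr q) 
        = - (n - 1) / r * B r powr (p - 1) - r * B r + \<alpha> * u r + u r powr q"
      unfolding F_eq[OF that] by (simp add: B_def)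
    moreover have "((\<lambda>s. (- spow (p - 1) (u' s)) powr (1 / (p - 1))) has_real_derivative
       1 / (p - 1) * (- spow (p - 1) (u' r)) powr (1 / (p - 1) - 1) *
       - (- (n - 1) / r * spow (p - 1) (u' r) - r * u' r - \<alpha> * u r - u r powr q)) (at r)"
      using DERIV_fun_powr[OF DERIV_minus[OF dF], of r "1 / (p - 1)"] that S'(1) B_pos[OF that] F_eq[OF that]
      by simp
    ultimately show "((\<lambda>s. (- spow (p - 1) (u' s)) powr (1 / (p - 1))) has_real_derivative B' r) (at r)"
      unfolding B'_def z by metis
  qed (use that in auto)
  define x where "x t = u (exp t) / (exp t * B (exp t))" for t
  \<comment> \<open>The summand 1 makes exp t > S' strict, as needed for u' < 0.\<close>
  define T where "T = ln (S' + 1)"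
  have "log_orbit n p q \<alpha> T (\<lambda>t. u (exp t)) x"
  proof
    have exp_gt: "exp t > S'" if "T \<le> t" for t
    proof -
      have "exp T \<le> exp t" using that by simp
      moreover have "exp T = S' + 1" using S'(1) \<open>S > 0\<close> by (simp add: T_def)
      ultimately show ?thesis by simp
    qed
    fix t assume "T \<le> t"
    define r where "r = exp t"
    have r: "r > S'" "r \<ge> S" "r > 0" using exp_gt[OF \<open>T \<le> t\<close>] S'(1) by (auto simp: r_def)
    note pos' = pos[OF r(2)] B_pos[OF r(1)] r(3)
    show "u (exp t) > 0" using pos' by (simp add: r_def)
    show "x t > 0" using pos' by (simp add: x_def r_def)
    have du_exp: "((\<lambda>t. u (exp t)) has_real_derivative - B r * r) (at t)"
      using DERIV_chain2[OF du[OF r(2), unfolded r_def] DERIV_exp] by (simp add: B_def r_def)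
    thus "((\<lambda>t. u (exp t)) has_real_derivative - u (exp t) / x t) (at t)"
      using pos' by (simp add: x_def r_def field_simps)
    have dB_exp: "((\<lambda>t. B (exp t)) has_real_derivative B' r * r) (at t)"
      using DERIV_chain2[OF B_deriv[OF r(1), unfolded r_def] DERIV_exp] by (simp add: r_def)
    define Z where "Z = B r powr (p - 1)"
    have "Z > 0" using pos' by (simp add: Z_def)
    have v_eq: "x t powr (1 - p) * u (exp t) powr (p - 2) * exp (- p * t) = Z / (r * u r)"
    proof -
      have 1: "x t powr (1 - p) = u r powr (1 - p) / (r powr (1 - p) * B r powr (1 - p))"
        using pos' unfolding x_def r_def[symmetric] by (simp add: powr_divide powr_mult)
      have 2: "B r powr (1 - p) = 1 / Z" using powr_minus_divide[of "B r" "p - 1"] by (simp add: Z_def)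
      have 3: "exp (- p * t) = r powr (- p)" by (simp add: r_def exp_powr_real mult.commute)
      have 4: "u r powr (1 - p) * u r powr (p - 2) = 1 / u r"
        using pos' by (simp add: powr_minus_divide flip: powr_add)
      have 5: "r powr (- p) / r powr (1 - p) = 1 / r"
        using pos' by (simp flip: powr_diff)
      have "x t powr (1 - p) * u r powr (p - 2) * exp (- p * t) 
          = Z * (u r powr (1 - p) * u r powr (p - 2)) * (r powr (- p) / r powr (1 - p))"
        unfolding 1 2 3 by simp
      thus ?thesis unfolding 4 5 by (simp add: r_def mult.commute)
    qed
    define E where "E = u r powr (q - 1)"
    have uq: "u r powr q = u r * E" using powr_add[of "u r" 1 "q - 1"] pos' by (simp add: E_def)
    have "(x has_real_derivative (- B r * r * (r * B r) - u r * (r * B r + B' r * r * r)) / (r * B r * (r * B r))) (at t)"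
      unfolding x_def[abs_def] 
      by (rule derivative_eq_intros du_exp dB_exp refl)+ (use pos' in \<open>auto simp: r_def algebra_simps\<close>)
    also have "(- B r * r * (r * B r) - u r * (r * B r + B' r * r * r)) / (r * B r * (r * B r))
       = - 1 - u r / (r * B r) - u r / (r * B r) * (r * (B' r / B r))"
      using pos' by (simp add: field_simps)
    also have "r * (B' r / B r) = 1 / (p - 1) * (- (n - 1) - r * r * B r / Z + r * u r * (\<alpha> + E) / Z)"
    proof -
      let ?W = "- (n - 1) / r * Z - r * B r + \<alpha> * u r + u r * E"
      have "r * (B' r / B r) = 1 / (p - 1) * (r * ?W / Z)"
        using pos' unfolding B'_def uq Z_def[symmetric] by simp
      also have "r * ?W / Z = - (n - 1) - r * r * B r / Z + r * u r * (\<alpha> + E) / Z"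
        using pos' \<open>Z > 0\<close> by (simp add: field_simps)
      finally show ?thesis .
    qed
    also have "- 1 - u r / (r * B r) - u r / (r * B r) * \<dots> 
        = - 1 + (n - p) / (p - 1) * (u r / (r * B r)) + (1 - (\<alpha> + E) * (u r / (r * B r))) / ((p - 1) * (Z / (r * u r)))"
    proof -
      \<comment> \<open>X is x and V is 1/v. The relation X Y = V turns the drift term r u' into the
        summand 1 of the factor 1 - (\<alpha> + E) X.\<close>
      define k X Y V where "k = p - 1" and "X = u r / (r * B r)" and "Y = r * r * B r / Z" and "V = r * u r / Z"
      have "k \<noteq> 0" and XY: "X * Y = V" and V': "k * (Z / (r * u r)) = k / V" and Va: "r * u r * (\<alpha> + E) / Z = V * (\<alpha> + E)"
        using pos' \<open>Z > 0\<close> p by (auto simp: k_def X_def Y_def V_def)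
      have "X * (1 / k * (- (n - 1) - Y + V * (\<alpha> + E))) = (- (n - 1) * X - X * Y + X * V * (\<alpha> + E)) / k"
        by (simp add: algebra_simps add_divide_distrib diff_divide_distrib)
      also have "\<dots> = (- (n - 1) * X - V * (1 - (\<alpha> + E) * X)) / k"
        unfolding XY by (simp add: algebra_simps)
      finally have "- 1 - X - X * (1 / k * (- (n - 1) - Y + V * (\<alpha> + E)))
          = - 1 + ((n - 1) * X - k * X) / k + V * (1 - (\<alpha> + E) * X) / k"
        using \<open>k \<noteq> 0\<close> by (simp add: field_simps)
      also have "(n - 1) * X - k * X = (n - p) * X" by (simp add: k_def algebra_simps)
      finally show ?thesis
        unfolding Va X_def[symmetric] Y_def[symmetric] k_def[symmetric] V' by (simp add: mult.commute)
    qed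
    finally show "(x has_real_derivative
      - 1 + (n - p) / (p - 1) * x t + (1 - (\<alpha> + u (exp t) powr (q - 1)) * x t)
        / ((p - 1) * (x t powr (1 - p) * u (exp t) powr (p - 2) * exp (- p * t)))) (at t)"
      unfolding v_eq by (simp add: x_def[abs_def] r_def E_def)
  next
    have "((\<lambda>t. exp t powr \<alpha> * u (exp t)) \<longlongrightarrow> 0) at_top"
      using filterlim_compose[OF decay exp_at_top] .
    thus "((\<lambda>t. exp (\<alpha> * t) * u (exp t)) \<longlongrightarrow> 0) at_top" 
      by (simp add: exp_powr_real mult.commute)
  qed (use assms in auto)
  thus ?thesis by blast
qed

section \<open>Transfer to the original variables in the three ranges of p\<close>

theorem proposition3p3:
  fixes N :: nat and p q \<alpha> \<delta> \<eta> p\<^sub>1 l \<rho> R :: real and w :: "real \<Rightarrow> real"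
  assumes "1 \<le> N" and "1 < p" and "p < 2" and "1 < q"
    and "\<delta> = p / (2 - p)"
    and "\<eta> = (real N - p) / (p - 1)"
    and "p\<^sub>1 = 2 * real N / (real N + 1)"
    and "l = (\<delta> powr (p - 1) * ((\<delta> - real N) / (\<delta> - \<alpha>))) powr (1 / (2 - p))"
    and "\<rho> = 1 / real N *
           (real N * (real N - 1) / (2 * (real N - \<alpha>))) powr ((real N + 1) / 2)"
    and "0 < \<alpha>" and "\<alpha> < \<delta>"
    and "is_solution N p q \<alpha> R w"
    and "((\<lambda>r. r powr \<alpha> * w r) \<longlongrightarrow> 0) at_top"
    and "finite {r \<in> {R<..}. w r = 0}"
  shows "(p\<^sub>1 < p \<longrightarrow>
            ((\<lambda>r. r powr \<delta> * w r) \<longlongrightarrow> l) at_top \<or>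
            ((\<lambda>r. r powr \<delta> * w r) \<longlongrightarrow> - l) at_top)
       \<and> (p < p\<^sub>1 \<longrightarrow>
            (\<exists>c. c \<noteq> 0 \<and> ((\<lambda>r. r powr \<eta> * w r) \<longlongrightarrow> c) at_top))
       \<and> (p = p\<^sub>1 \<longrightarrow>
            ((\<lambda>r. r ^ N * ln r powr ((real N + 1) / 2) * w r) \<longlongrightarrow> \<rho>) at_top \<or>
            ((\<lambda>r. r ^ N * ln r powr ((real N + 1) / 2) * w r) \<longlongrightarrow> - \<rho>) at_top)"
proof -
  note derivs = is_solution_derivs[OF \<open>is_solution N p q \<alpha> R w\<close>]
  have "R \<ge> 0" using \<open>is_solution N p q \<alpha> R w\<close> by (simp add: is_solution_def)
  have "continuous_on {R<..} w"
    using derivs(1) by (intro DERIV_continuous_on) (auto intro: DERIV_subset)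
  then obtain S \<sigma> where S: "S > R" "\<sigma> \<in> {1, - 1 :: real}" "\<And>r. r \<ge> S \<Longrightarrow> \<sigma> * w r > 0"
    using eventually_sign_of_finite_zeros assms(14) by metis
  have spow_\<sigma>: "spow a (\<sigma> * z) = \<sigma> * spow a z" for a z
    using S(2) by (auto simp: spow_minus)
  have "\<exists>T x. log_orbit (real N) p q \<alpha> T (\<lambda>t. \<sigma> * w (exp t)) x"
  proof (rule log_orbit_of_positive_solution)
    fix r assume "r \<ge> S"
    hence "r > R" using S(1) by simp
    show "((\<lambda>r. \<sigma> * w r) has_real_derivative \<sigma> * deriv w r) (at r)"
      by (rule DERIV_cmult[OF derivs(1)[OF \<open>r > R\<close>]])
    have "spow q (\<sigma> * w r) = (\<sigma> * w r) powr q"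
      using S(3)[OF \<open>r \<ge> S\<close>] by (simp add: spow_nonneg)
    thus "((\<lambda>s. spow (p - 1) (\<sigma> * deriv w s)) has_real_derivative
      - (real N - 1) / r * spow (p - 1) (\<sigma> * deriv w r) - r * (\<sigma> * deriv w r) - \<alpha> * (\<sigma> * w r)
        - (\<sigma> * w r) powr q) (at r)"
      using DERIV_cmult[OF derivs(2)[OF \<open>r > R\<close>], of \<sigma>] unfolding spow_\<sigma> 
      by (simp add: algebra_simps)
  next
    show "((\<lambda>r. r powr \<alpha> * (\<sigma> * w r)) \<longlongrightarrow> 0) at_top"
      using tendsto_mult_right_zero[OF assms(13), of \<sigma>] by (simp add: mult.left_commute)
  qed (use assms S \<open>R \<ge> 0\<close> in auto)
  then obtain T x where "log_orbit (real N) p q \<alpha> T (\<lambda>t. \<sigma> * w (exp t)) x" by blast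
  then interpret o: log_orbit "real N" p q \<alpha> T "\<lambda>t. \<sigma> * w (exp t)" x .
  have \<delta>: "o.\<delta> = \<delta>" and \<eta>: "o.\<eta> = \<eta>" using assms(5,6) o.\<delta>_def o.\<eta>_def by auto
  \<comment> \<open>Since \<sigma> \<sigma> = 1, multiplying by \<sigma> once more recovers w from
    its positive version; this is where the sign of the limit arises.\<close>
  have limit: "((\<lambda>r. h r * w r) \<longlongrightarrow> \<sigma> * c) at_top"
    if "((\<lambda>t. h (exp t) * (\<sigma> * w (exp t))) \<longlongrightarrow> c) at_top" for h c
  proof -
    have "((\<lambda>r. h r * (\<sigma> * w r)) \<longlongrightarrow> c) at_top" using that by (rule tendsto_of_exp)
    hence "((\<lambda>r. \<sigma> * (h r * (\<sigma> * w r))) \<longlongrightarrow> \<sigma> * c) at_top" by (rule tendsto_mult_left)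
    moreover have "\<sigma> * (z * (\<sigma> * y)) = z * y" for y z using S(2) by auto
    ultimately show ?thesis by simp
  qed
  \<comment> \<open>After clearing the positive denominators N + 1 and 2 - p, both comparisons are
    between 2 N and p (N + 1).\<close>
  have p\<^sub>1_less: "p\<^sub>1 < p \<longleftrightarrow> real N < \<delta>" and less_p\<^sub>1: "p < p\<^sub>1 \<longleftrightarrow> \<delta> < real N"
    using assms(1-3) unfolding assms(5,7)
    by (simp_all add: pos_divide_less_eq pos_less_divide_eq algebra_simps)
  show ?thesis
  proof (intro conjI impI)
    assume "p\<^sub>1 < p"
    hence "real N < \<delta>" using p\<^sub>1_less by simp
    have K_pos: "\<delta> powr (p - 1) * ((\<delta> - real N) / (\<delta> - \<alpha>)) > 0"
      using \<open>real N < \<delta>\<close> \<open>\<alpha> < \<delta>\<close> \<open>0 < \<alpha>\<close> by simp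
    have "1 / (2 - p) * (2 - p) = 1" using assms(3) by simp
    hence "l powr (2 - p) = \<delta> powr (p - 1) * ((\<delta> - real N) / (\<delta> - \<alpha>))"
      unfolding assms(8) powr_powr using K_pos by (simp only: powr_one less_imp_le)
    moreover have "l > 0" unfolding assms(8) powr_gt_zero using K_pos by (metis less_irrefl)
    ultimately interpret sup: log_orbit_supercritical "real N" p q \<alpha> T "\<lambda>t. \<sigma> * w (exp t)" x l
      by unfold_locales (use \<open>real N < \<delta>\<close> in \<open>auto simp: \<delta>\<close>)
    have "((\<lambda>t. exp (\<delta> * t) * (\<sigma> * w (exp t))) \<longlongrightarrow> l) at_top"
      using sup.y_tendsto unfolding o.y_def[abs_def] \<delta> .
    hence "((\<lambda>t. exp t powr \<delta> * (\<sigma> * w (exp t))) \<longlongrightarrow> l) at_top"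
      by (simp add: exp_powr_real mult.commute)
    hence "((\<lambda>r. r powr \<delta> * w r) \<longlongrightarrow> \<sigma> * l) at_top" by (rule limit)
    thus "((\<lambda>r. r powr \<delta> * w r) \<longlongrightarrow> l) at_top \<or> ((\<lambda>r. r powr \<delta> * w r) \<longlongrightarrow> - l) at_top"
      using S(2) by auto
  next
    assume "p < p\<^sub>1"
    hence "\<delta> < real N" using less_p\<^sub>1 by simp
    interpret sub: log_orbit_subcritical "real N" p q \<alpha> T "\<lambda>t. \<sigma> * w (exp t)" x
      by unfold_locales (use \<open>\<delta> < real N\<close> in \<open>simp add: \<delta>\<close>)
    obtain c where c: "c > 0" "((\<lambda>t. exp (\<eta> * t) * (\<sigma> * w (exp t))) \<longlongrightarrow> c) at_top"
      using sub.subcritical_tendsto \<open>\<delta> < real N\<close> unfolding \<delta> \<eta> by blast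
    have "((\<lambda>t. exp t powr \<eta> * (\<sigma> * w (exp t))) \<longlongrightarrow> c) at_top"
      using c(2) by (simp add: exp_powr_real mult.commute)
    hence "((\<lambda>r. r powr \<eta> * w r) \<longlongrightarrow> \<sigma> * c) at_top" by (rule limit)
    moreover have "\<sigma> * c \<noteq> 0" using S(2) c(1) by auto
    ultimately show "\<exists>c. c \<noteq> 0 \<and> ((\<lambda>r. r powr \<eta> * w r) \<longlongrightarrow> c) at_top" by blast
  next
    assume "p = p\<^sub>1"
    hence "\<delta> = real N" using p\<^sub>1_less less_p\<^sub>1 by auto
    interpret sub: log_orbit_subcritical "real N" p q \<alpha> T "\<lambda>t. \<sigma> * w (exp t)" x
      by unfold_locales (use \<open>\<delta> = real N\<close> in \<open>simp add: \<delta>\<close>)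
    \<comment> \<open>At the critical exponent these values turn the general constant and exponent
      into \<rho> and (N + 1)/2.\<close>
    have p2: "2 - p = 2 / (real N + 1)" and p1: "p - 1 = (real N - 1) / (real N + 1)"
      unfolding \<open>p = p\<^sub>1\<close> assms(7) by (auto simp: field_simps)
    have e1: "1 / (2 - p) = (real N + 1) / 2" unfolding p2 by simp
    have "(p - 1) * real N / ((2 - p) * (real N - \<alpha>)) = real N * (real N - 1) / (2 * (real N - \<alpha>))"
    proof -
      have "(b / d) * a / ((2 / d) * c) = a * b / (2 * c)" if "d \<noteq> 0" for a b c d :: real
        using that by simp
      thus ?thesis unfolding p1 p2 by simp
    qed
    hence "((\<lambda>t. exp (real N * t) * t powr ((real N + 1) / 2) * (\<sigma> * w (exp t))) \<longlongrightarrow> \<rho>) at_top"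
      using sub.critical_tendsto \<open>\<delta> = real N\<close> unfolding \<delta> e1 assms(9) by simp
    hence "((\<lambda>t. exp t ^ N * ln (exp t) powr ((real N + 1) / 2) * (\<sigma> * w (exp t))) \<longlongrightarrow> \<rho>) at_top"
      by (simp add: exp_of_nat_mult)
    hence "((\<lambda>r. r ^ N * ln r powr ((real N + 1) / 2) * w r) \<longlongrightarrow> \<sigma> * \<rho>) at_top" by (rule limit)
    thus "((\<lambda>r. r ^ N * ln r powr ((real N + 1) / 2) * w r) \<longlongrightarrow> \<rho>) at_top \<or>
        ((\<lambda>r. r ^ N * ln r powr ((real N + 1) / 2) * w r) \<longlongrightarrow> - \<rho>) at_top"
      using S(2) by auto
  qed
qed

end
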